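(* Let $p\in(1,\infty)$, $q=p/(p-1)$, and $s\in(0,1]$. Suppose $\varphi\in\mathcal{L}_p(\mathbb{R}^d)\cap\mathcal{P}$, $f_0\in\mathcal{W}^{s,p}(\mathbb{R}^d)\cap\mathcal{P}$, and $$\int_{\mathbb{R}^d}\|x\|_2^s\,\varphi(x)\,dx\le K_1$$ for a finite constant $K_1>0$. Then there exists a sequence $(f_m)_{m\in\mathbb{N}}$ with $f_m\in\mathrm{co}_m(\mathcal{P}_\varphi)$ for each $m\in\mathbb{N}$, such that $$\|f_m-f_0\|_p\le\begin{cases}K\,m^{-\frac{s}{sq+d}}&\text{if }1<p<2,\\ K\,m^{-\frac{sq}{2(sq+d)}}&\text{if }2\le p<\infty,\end{cases}$$ where $K$ is a finite constant that is a function of $s,K_1,p,d,\varphi$ and depends on $f_0$ only via $\|f_0\|_{s,p}$ when $s<1$, and only via $\left[\int_{\mathbb{R}^d}\|\nabla f_0(x)\|_2^p\,dx\right]^{1/p}$ when $s=1$.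
   Context: $\mathcal{P}$ is the set of all probability density functions on $\mathbb{R}^d$ (Lebesgue-measurable, nonnegative, integrating to one). For $\varphi\in\mathcal{P}$ and $\nu>0$, $\varphi_\nu(x)=\nu^d\varphi(\nu x)$, and $\mathcal{P}_\varphi=\{x\mapsto\varphi_\nu(x-\mu) : \mu\in\mathbb{R}^d,\ \nu>0\}$. For $\mathcal{Q}\subset\mathcal{P}$, $\mathrm{co}_m(\mathcal{Q})=\{\sum_{j=1}^m\pi_jq_j : q_j\in\mathcal{Q},\ \pi_j\ge0,\ \sum_{j=1}^m\pi_j=1\}$. Sobolev spaces: $\mathcal{W}^{1,p}$ is the space of $f\in\mathcal{L}_p$ with first-order weak partial derivatives $D_kf\in\mathcal{L}_p$, $k=1,\dots,d$, and $\nabla f=(D_1f,\dots,D_df)$. For $s\in(0,1)$, $\mathcal{W}^{s,p}$ is the space of $f\in\mathcal{L}_p$ with $$\|f\|_{s,p}=\left[\int_{\mathbb{R}^d}\int_{\mathbb{R}^d}\frac{|f(x)-f(y)|^p}{\|x-y\|_2^{d+sp}}\,dx\,dy\right]^{1/p}<\infty.$$ For $s=1$, $\mathcal{W}^{s,p}$ means $\mathcal{W}^{1,p}$. *)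

theory Defs
  imports "HOL-Analysis.Analysis"
begin

definition densities :: "(real ^ 'd \<Rightarrow> real) set" where
  "densities = {f \<in> borel_measurable lebesgue.
     (\<forall>x. 0 \<le> f x) \<and> (\<integral>\<^sup>+x. ennreal (f x) \<partial>lebesgue) = 1}"

definition dilate :: "real \<Rightarrow> (real ^ 'd \<Rightarrow> real) \<Rightarrow> real ^ 'd \<Rightarrow> real" where
  "dilate \<nu> \<phi> x = \<nu> ^ CARD('d) * \<phi> (\<nu> *\<^sub>R x)"

definition location_scale_family ::
  "(real ^ 'd \<Rightarrow> real) \<Rightarrow> (real ^ 'd \<Rightarrow> real) set" where
  "location_scale_family \<phi> = {(\<lambda>x. dilate \<nu> \<phi> (x - \<mu>)) | \<mu> \<nu>. 0 < \<nu>}"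

text \<open>The components need not be distinct, and for \<open>m = 0\<close> the set is empty.\<close>

definition mixtures ::
  "nat \<Rightarrow> (real ^ 'd \<Rightarrow> real) set \<Rightarrow> (real ^ 'd \<Rightarrow> real) set" where
  "mixtures m Q = {(\<lambda>x. \<Sum>j<m. w j * g j x) | w g.
     (\<forall>j<m. g j \<in> Q) \<and> (\<forall>j<m. 0 \<le> w j) \<and> (\<Sum>j<m. w j) = 1}"

text \<open>
  Elements of \<open>L\<^sub>p\<close> are represented by functions rather than by classes modulo
  null sets. \<open>Lp_norm\<close> is meaningful only on \<open>Lp_space\<close>, because the Bochner
  integral of a non-integrable function is \<open>0\<close>.
\<close>

definition Lp_space :: "real \<Rightarrow> (real ^ 'd \<Rightarrow> real) set" where
  "Lp_space p = {f \<in> borel_measurable lebesgue. integrable lebesgue (\<lambda>x. \<bar>f x\<bar> powr p)}"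

definition Lp_norm :: "real \<Rightarrow> (real ^ 'd \<Rightarrow> real) \<Rightarrow> real" where
  "Lp_norm p f = (\<integral>x. \<bar>f x\<bar> powr p \<partial>lebesgue) powr (1 / p)"

definition partial :: "'d \<Rightarrow> (real ^ 'd \<Rightarrow> real) \<Rightarrow> real ^ 'd \<Rightarrow> real" where
  "partial k f x = frechet_derivative f (at x) (axis k 1)"

primrec times_continuously_differentiable :: "nat \<Rightarrow> (real ^ 'd \<Rightarrow> real) \<Rightarrow> bool" where
  "times_continuously_differentiable 0 f \<longleftrightarrow> continuous_on UNIV f"
| "times_continuously_differentiable (Suc n) f \<longleftrightarrow>
     (\<forall>x. f differentiable (at x)) \<and> (\<forall>k. times_continuously_differentiable n (partial k f))"

definition test_functions :: "(real ^ 'd \<Rightarrow> real) set" where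
  "test_functions = {\<psi>. (\<forall>n. times_continuously_differentiable n \<psi>) \<and>
     compact (closure {x. \<psi> x \<noteq> 0})}"

definition locally_integrable :: "(real ^ 'd \<Rightarrow> real) \<Rightarrow> bool" where
  "locally_integrable f \<longleftrightarrow> (\<forall>C. compact C \<longrightarrow> set_integrable lebesgue C f)"

definition has_weak_partial ::
  "(real ^ 'd \<Rightarrow> real) \<Rightarrow> 'd \<Rightarrow> (real ^ 'd \<Rightarrow> real) \<Rightarrow> bool" where
  "has_weak_partial f k g \<longleftrightarrow> locally_integrable f \<and> locally_integrable g \<and>
     (\<forall>\<psi>\<in>test_functions.
        (\<integral>x. f x * partial k \<psi> x \<partial>lebesgue) = - (\<integral>x. g x * \<psi> x \<partial>lebesgue))"

text \<open>
  A weak partial derivative is unique up to a null set, so the choice of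
  representative affects neither membership in \<open>L\<^sub>p\<close> nor the norm of the gradient.
\<close>

definition weak_partial :: "'d \<Rightarrow> (real ^ 'd \<Rightarrow> real) \<Rightarrow> real ^ 'd \<Rightarrow> real" where
  "weak_partial k f = (SOME g. has_weak_partial f k g)"

definition weak_gradient :: "(real ^ 'd \<Rightarrow> real) \<Rightarrow> real ^ 'd \<Rightarrow> real ^ 'd" where
  "weak_gradient f x = (\<chi> k. weak_partial k f x)"

text \<open>On the diagonal the quotient is \<open>0 / 0 = 0\<close>; the diagonal is a null set.\<close>

definition slobodeckij_integral :: "real \<Rightarrow> real \<Rightarrow> (real ^ 'd \<Rightarrow> real) \<Rightarrow> ennreal" where
  "slobodeckij_integral s p f =
     (\<integral>\<^sup>+x. \<integral>\<^sup>+y. ennreal (\<bar>f x - f y\<bar> powr p / norm (x - y) powr (real CARD('d) + s * p))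
        \<partial>lebesgue \<partial>lebesgue)"

definition sobolev_space :: "real \<Rightarrow> real \<Rightarrow> (real ^ 'd \<Rightarrow> real) set" where
  "sobolev_space s p =
     (if s = 1
      then {f \<in> Lp_space p. \<forall>k. \<exists>g\<in>Lp_space p. has_weak_partial f k g}
      else {f \<in> Lp_space p. slobodeckij_integral s p f < \<infinity>})"

text \<open>
  For \<open>s \<in> (0,1)\<close> this is the Gagliardo--Slobodeckij expression and for \<open>s = 1\<close> the
  \<open>L\<^sub>p\<close> norm of the Euclidean length of the gradient; neither includes the \<open>L\<^sub>p\<close> norm
  of \<open>f\<close> itself.
\<close>

definition sobolev_seminorm :: "real \<Rightarrow> real \<Rightarrow> (real ^ 'd \<Rightarrow> real) \<Rightarrow> real" where
  "sobolev_seminorm s p f =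
     (if s = 1
      then (\<integral>x. norm (weak_gradient f x) powr p \<partial>lebesgue) powr (1 / p)
      else enn2real (slobodeckij_integral s p f) powr (1 / p))"

end

theory Submission
  imports Defs
begin

text \<open>
  Write \<open>\<phi>\<^sub>\<nu>\<close> for the dilate of \<open>\<phi>\<close>. The convolution \<open>g = f\<^sub>0 * \<phi>\<^sub>\<nu>\<close> is an infinite mixture of translates
  of \<open>\<phi>\<^sub>\<nu>\<close> with mixing density \<open>f\<^sub>0\<close>. It is close to \<open>f\<^sub>0\<close> when \<open>\<nu>\<close> is large, and it is close to a mixture of
  \<open>m\<close> of its components when \<open>m\<close> is large compared with \<open>\<nu>\<close>. Balancing the two errors gives the rate.

  Smoothing error. Let \<open>W(z)\<close> be the \<open>p\<close>-th power of the \<open>L\<^sub>p\<close> norm of \<open>f\<^sub>0(\<cdot> - z) - f\<^sub>0\<close>. Membership of \<open>f\<^sub>0\<close> in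
  the Sobolev space gives \<open>W(z) \<le> T |z|\<^sup>s\<^sup>p\<close>, where \<open>T\<close> is a multiple of the \<open>p\<close>-th power of the seminorm
  (\<open>translation_energy_le_sobolev_seminorm\<close>). For \<open>s < 1\<close> this follows from \<open>W(z) \<le> 2\<^sup>p\<^sup>-\<^sup>1 (W(w) + W(z - w))\<close>
  by averaging over \<open>w\<close> in a ball of volume proportional to \<open>|z|\<^sup>d\<close>: the average is at most a multiple of the
  Slobodeckij integral. For \<open>s = 1\<close> it follows from the identity
  \<open>f(x + z) - f(x) = \<integral>\<^sub>0\<^sup>1 z \<bullet> \<nabla>f(x + t z) dt\<close> for almost every \<open>x\<close>, which is verified by integrating both sides
  against test functions. Jensen's inequality for the weight \<open>|z|\<^sup>s \<phi>\<^sub>\<nu>(z)\<close>, whose mass is at most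
  \<open>K\<^sub>1 \<nu>\<^sup>-\<^sup>s\<close>, then bounds the \<open>p\<close>-th power of the norm of \<open>g - f\<^sub>0\<close> by \<open>(K\<^sub>1 \<nu>\<^sup>-\<^sup>s)\<^sup>p T\<close>
  (\<open>convolution_error_le\<close>).

  Discretization error. Instead of sampling the locations at random, they are chosen one after the other. Let \<open>S\<close>
  be the sum of the deviations \<open>\<phi>\<^sub>\<nu>(\<cdot> - \<mu>\<^sub>j) - g\<close> chosen so far. The expansion of \<open>|a + b|\<^sup>p\<close> around \<open>a\<close> has a term
  linear in \<open>b\<close>, and averaging over \<open>\<mu>\<close> with density \<open>f\<^sub>0\<close> makes this term vanish. Hence some \<open>\<mu>\<close> does at least
  as well as the remaining terms on average (\<open>greedy_step\<close>). By induction the \<open>p\<close>-th power of the norm of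
  the sum of \<open>m\<close> deviations is of order \<open>m\<^sup>r\<close> with \<open>r = max 1 (p/2)\<close>, times the \<open>p\<close>-th power of the norm of
  \<open>\<phi>\<^sub>\<nu>\<close>, which is proportional to \<open>\<nu>\<close> to the power \<open>d (p - 1)\<close> (\<open>Lp_empirical_approximation\<close>).

  With \<open>\<nu> = m\<^sup>a\<close> and \<open>a = (p - r) / (s p + d (p - 1))\<close> both \<open>p\<close>-th powers are multiples of \<open>m\<close> to the power
  \<open>- a s p\<close>, and \<open>a s\<close> is the exponent of the theorem.
\<close>

section \<open>Second-order bounds for the power function\<close>

text \<open>
  A convex function lies above its tangents. For positive arguments this is Young's inequality for
  \<open>y\<close> and \<open>x powr (r - 1)\<close>.
\<close>

lemma powr_tangent_le:
  fixes x y r :: real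
  assumes "1 \<le> r" "0 \<le> x" "0 \<le> y"
  shows "x powr r + r * x powr (r - 1) * (y - x) \<le> y powr r"
proof (cases "r = 1 \<or> x = 0")
  case True
  then show ?thesis using assms by (auto simp: powr_zero_eq_one)
next
  case False
  then have r: "1 < r" and x: "0 < x" using assms by auto
  have "y * x powr (r - 1) \<le> y powr r / r + (x powr (r - 1)) powr (r / (r - 1)) / (r / (r - 1))"
    using r assms by (intro Youngs_inequality) (auto simp: divide_simps)
  also have "(x powr (r - 1)) powr (r / (r - 1)) = x powr r"
    using r by (simp add: powr_powr)
  finally have "r * (y * x powr (r - 1)) \<le> r * (y powr r / r + x powr r / (r / (r - 1)))"
    using r by (intro mult_left_mono) auto
  also have "\<dots> = y powr r + (r - 1) * x powr r"
    using r by (simp add: field_simps)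
  finally have "r * (y * x powr (r - 1)) \<le> y powr r + (r - 1) * x powr r" .
  moreover have "x powr (r - 1) * x = x powr r"
    using x by (simp add: powr_diff)
  ultimately show ?thesis by (simp add: algebra_simps)
qed

lemma abs_powr_tangent_le:
  fixes x y p :: real
  assumes "1 \<le> p"
  shows "\<bar>x\<bar> powr p + p * (sgn x * \<bar>x\<bar> powr (p - 1)) * (y - x) \<le> \<bar>y\<bar> powr p"
proof -
  have "sgn x * (y - x) \<le> \<bar>y\<bar> - \<bar>x\<bar>"
    by (auto simp: sgn_if)
  then have "p * \<bar>x\<bar> powr (p - 1) * (sgn x * (y - x)) \<le> p * \<bar>x\<bar> powr (p - 1) * (\<bar>y\<bar> - \<bar>x\<bar>)"
    using assms by (intro mult_left_mono) auto
  moreover have "p * (sgn x * \<bar>x\<bar> powr (p - 1)) * (y - x) = p * \<bar>x\<bar> powr (p - 1) * (sgn x * (y - x))"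
    by (simp add: mult_ac)
  ultimately show ?thesis
    using powr_tangent_le[of p "\<bar>x\<bar>" "\<bar>y\<bar>"] assms by linarith
qed

lemma powr_add_le_add_powr:
  fixes x y r :: real
  assumes "0 < r" "r \<le> 1" "0 \<le> x" "0 \<le> y"
  shows "(x + y) powr r \<le> x powr r + y powr r"
proof (cases "x + y = 0")
  case False
  then have s: "0 < x + y" using assms by simp
  have le: "t \<le> t powr r" if "0 \<le> t" "t \<le> 1" for t :: real
    using powr_mono'[of r 1 t] that assms by (cases "t = 0") auto
  have "1 = x / (x + y) + y / (x + y)"
    using s by (simp flip: add_divide_distrib)
  also have "\<dots> \<le> (x / (x + y)) powr r + (y / (x + y)) powr r"
    using s assms by (intro add_mono le) auto
  also have "\<dots> = (x powr r + y powr r) / (x + y) powr r"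
    using s assms by (simp add: powr_divide add_divide_distrib)
  finally show ?thesis
    using s by (simp add: field_simps)
qed (use assms in auto)

text \<open>
  Up to the factor \<open>p\<close>, \<open>sgn u * |u| powr (p - 1)\<close> is the derivative of
  \<open>|u| powr p\<close>; this estimate of its increments serves \<open>p \<le> 2\<close>, the
  next one \<open>p \<ge> 2\<close>.
\<close>

lemma signed_powr_Holder:
  fixes u v r :: real
  assumes r: "0 < r" "r \<le> 1"
  shows "\<bar>sgn u * \<bar>u\<bar> powr r - sgn v * \<bar>v\<bar> powr r\<bar> \<le> 2 * \<bar>u - v\<bar> powr r"
proof -
  have *: "\<bar>x powr r - y powr r\<bar> \<le> \<bar>x - y\<bar> powr r" if "0 \<le> x" "0 \<le> y" for x y :: real
  proof (cases "x \<le> y")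
    case True
    then show ?thesis
      using powr_add_le_add_powr[OF r, of x "y - x"] that powr_mono2[of r x y] r
      by (auto simp: abs_if)
  next
    case False
    then show ?thesis
      using powr_add_le_add_powr[OF r, of y "x - y"] that powr_mono2[of r y x] r
      by (auto simp: abs_if)
  qed
  have opp: "x powr r + y powr r \<le> 2 * (x + y) powr r" if "0 \<le> x" "0 \<le> y" for x y :: real
    using powr_mono2[of r x "x + y"] powr_mono2[of r y "x + y"] that r by simp
  consider "0 \<le> u" "0 \<le> v" | "u \<le> 0" "v \<le> 0" | "0 < u" "v < 0" | "u < 0" "0 < v" by linarith
  then show ?thesis
  proof cases
    case 1
    have "sgn u * \<bar>u\<bar> powr r = u powr r" "sgn v * \<bar>v\<bar> powr r = v powr r"
      using 1 by (auto simp: sgn_if)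
    moreover have "0 \<le> \<bar>u - v\<bar> powr r" by simp
    ultimately show ?thesis using *[OF 1] by linarith
  next
    case 2
    have "sgn u * \<bar>u\<bar> powr r = - ((- u) powr r)" "sgn v * \<bar>v\<bar> powr r = - ((- v) powr r)"
      using 2 by (auto simp: sgn_if)
    moreover have "\<bar>(- u) - (- v)\<bar> = \<bar>u - v\<bar>" by simp
    moreover have "0 \<le> \<bar>u - v\<bar> powr r" by simp
    ultimately show ?thesis using *[of "- u" "- v"] 2 by (smt (verit))
  next
    case 3
    then show ?thesis using opp[of u "- v"] by (auto simp: sgn_if)
  next
    case 4
    then have "\<bar>- ((- u) powr r) - v powr r\<bar> = (- u) powr r + v powr r"
      using powr_ge_zero[of "- u" r] powr_ge_zero[of v r] by linarith
    then show ?thesis using opp[of "- u" v] 4 by (simp add: sgn_if)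
  qed
qed

lemma signed_powr_Lipschitz:
  fixes u v r M :: real
  assumes r: "1 \<le> r" and M: "\<bar>u\<bar> \<le> M" "\<bar>v\<bar> \<le> M"
  shows "\<bar>sgn u * \<bar>u\<bar> powr r - sgn v * \<bar>v\<bar> powr r\<bar> \<le> r * M powr (r - 1) * \<bar>u - v\<bar>"
proof -
  have one: "x powr r - y powr r \<le> r * M powr (r - 1) * (x - y)"
    if "0 \<le> y" "y \<le> x" "x \<le> M" for x y :: real
  proof -
    have "x powr r - y powr r \<le> r * x powr (r - 1) * (x - y)"
      using powr_tangent_le[of r x y] r that by (simp add: algebra_simps)
    also have "\<dots> \<le> r * M powr (r - 1) * (x - y)"
      using r that by (intro mult_right_mono mult_left_mono powr_mono2) auto
    finally show ?thesis .
  qed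
  have *: "\<bar>x powr r - y powr r\<bar> \<le> r * M powr (r - 1) * \<bar>x - y\<bar>"
    if "0 \<le> x" "0 \<le> y" "x \<le> M" "y \<le> M" for x y :: real
    using one[of x y] one[of y x] powr_mono2[of r x y] powr_mono2[of r y x] that r
    by (cases "x \<le> y") (auto simp: abs_if)
  have opp: "x powr r + y powr r \<le> r * M powr (r - 1) * (x + y)"
    if "0 \<le> x" "0 \<le> y" "x \<le> M" "y \<le> M" for x y :: real
    using one[of 0 x] one[of 0 y] that r by (simp add: algebra_simps)
  consider "0 \<le> u" "0 \<le> v" | "u \<le> 0" "v \<le> 0" | "0 < u" "v < 0" | "u < 0" "0 < v" by linarith
  then show ?thesis
  proof cases
    case 1
    have "sgn u * \<bar>u\<bar> powr r = u powr r" "sgn v * \<bar>v\<bar> powr r = v powr r"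
      using 1 by (auto simp: sgn_if)
    then show ?thesis using *[of u v] M 1 by (simp only: abs_of_nonneg)
  next
    case 2
    have "sgn u * \<bar>u\<bar> powr r = - ((- u) powr r)" "sgn v * \<bar>v\<bar> powr r = - ((- v) powr r)"
      using 2 by (auto simp: sgn_if)
    moreover have "\<bar>(- u) - (- v)\<bar> = \<bar>u - v\<bar>" by simp
    ultimately show ?thesis using *[of "- u" "- v"] 2 M by (smt (verit))
  next
    case 3
    then show ?thesis using opp[of u "- v"] M by (auto simp: sgn_if)
  next
    case 4
    then have "\<bar>- ((- u) powr r) - v powr r\<bar> = (- u) powr r + v powr r"
      using powr_ge_zero[of "- u" r] powr_ge_zero[of v r] by linarith
    then show ?thesis using opp[of "- u" v] M 4 by (simp add: sgn_if)
  qed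
qed

text \<open>
  The tangent of \<open>|.| powr p\<close> at \<open>a + b\<close>, evaluated at \<open>a\<close>,
  bounds the increment of the function by its derivative at \<open>a + b\<close> times
  \<open>b\<close>. So the remainder of the first-order expansion at \<open>a\<close> is governed by
  how much the derivative changes between \<open>a\<close> and \<open>a + b\<close>.
\<close>

lemma abs_powr_add_le_derivative_increment:
  fixes a b p :: real
  assumes "1 \<le> p"
  shows "\<bar>a + b\<bar> powr p \<le> \<bar>a\<bar> powr p + p * (sgn a * \<bar>a\<bar> powr (p - 1)) * b
     + p * (\<bar>sgn (a + b) * \<bar>a + b\<bar> powr (p - 1) - sgn a * \<bar>a\<bar> powr (p - 1)\<bar> * \<bar>b\<bar>)"
proof -
  define J where "J = (\<lambda>u::real. sgn u * \<bar>u\<bar> powr (p - 1))"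
  have "\<bar>a + b\<bar> powr p \<le> \<bar>a\<bar> powr p + p * J (a + b) * b"
    using abs_powr_tangent_le[OF assms, of "a + b" a] by (simp add: J_def)
  also have "\<dots> = \<bar>a\<bar> powr p + p * J a * b + p * ((J (a + b) - J a) * b)"
    by (simp add: algebra_simps)
  also have "\<dots> \<le> \<bar>a\<bar> powr p + p * J a * b + p * (\<bar>J (a + b) - J a\<bar> * \<bar>b\<bar>)"
    using assms abs_le_D1[OF order_refl, of "(J (a + b) - J a) * b"]
    by (intro add_left_mono mult_left_mono) (auto simp: abs_mult)
  finally show ?thesis by (simp add: J_def)
qed

text \<open>
  The parameter \<open>n\<close> is the number of summands already collected in \<open>a\<close>.
  Multiplying by \<open>1 + r / (2 * n)\<close> in step \<open>n\<close>, with \<open>r = max 1 (p /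
  2)\<close>, lets \<open>|a| powr p\<close> grow only like \<open>n powr (r / 2)\<close>, so that
  the last term determines the growth of order \<open>n powr r\<close>.
\<close>

definition second_order_powr_bound :: "real \<Rightarrow> real \<Rightarrow> bool" where
  "second_order_powr_bound p C \<longleftrightarrow> 0 \<le> C \<and> (\<forall>n a b. 1 \<le> n \<longrightarrow>
     \<bar>a + b\<bar> powr p \<le> (1 + max 1 (p / 2) / (2 * n)) * \<bar>a\<bar> powr p
       + p * (sgn a * \<bar>a\<bar> powr (p - 1)) * b + C * n powr (max 1 (p / 2) - 1) * \<bar>b\<bar> powr p)"

text \<open>
  For \<open>p \<le> 2\<close> the derivative is Hoelder continuous of order \<open>p - 1\<close>
  and the remainder is a multiple of \<open>|b| powr p\<close>. For \<open>p > 2\<close> it is at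
  most a multiple of \<open>(|a| + |b|) powr (p - 2) * b\<^sup>2\<close>, and whether
  \<open>|b|\<close> is below or above a threshold of order \<open>|a| / sqrt n\<close> decides
  which of the two other terms absorbs it.
\<close>

lemma second_order_powr_bound_exists:
  fixes p :: real
  assumes p: "1 < p"
  shows "\<exists>C. second_order_powr_bound p C"
proof (cases "p \<le> 2")
  case True
  define r where "r = max 1 (p / 2)"
  have r: "r = 1" using True by (simp add: r_def)
  have "\<bar>a + b\<bar> powr p \<le> (1 + r / (2 * n)) * \<bar>a\<bar> powr p + p * (sgn a * \<bar>a\<bar> powr (p - 1)) * b
         + 2 * p * n powr (r - 1) * \<bar>b\<bar> powr p" if n: "1 \<le> n" for n a b :: real
  proof -
    have "\<bar>sgn (a + b) * \<bar>a + b\<bar> powr (p - 1) - sgn a * \<bar>a\<bar> powr (p - 1)\<bar> * \<bar>b\<bar>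
       \<le> 2 * \<bar>b\<bar> powr (p - 1) * \<bar>b\<bar>"
      using signed_powr_Holder[of "p - 1" "a + b" a] p True by (intro mult_right_mono) auto
    also have "\<dots> = 2 * \<bar>b\<bar> powr p"
      using p by (cases "b = 0") (auto simp: powr_diff)
    finally have "p * (\<bar>sgn (a + b) * \<bar>a + b\<bar> powr (p - 1) - sgn a * \<bar>a\<bar> powr (p - 1)\<bar> * \<bar>b\<bar>)
       \<le> p * (2 * \<bar>b\<bar> powr p)" using p by (intro mult_left_mono) auto
    also have "\<dots> = 2 * p * n powr (r - 1) * \<bar>b\<bar> powr p" using n r by simp
    finally have "p * (\<bar>sgn (a + b) * \<bar>a + b\<bar> powr (p - 1) - sgn a * \<bar>a\<bar> powr (p - 1)\<bar> * \<bar>b\<bar>)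
       \<le> 2 * p * n powr (r - 1) * \<bar>b\<bar> powr p" .
    moreover have "\<bar>a\<bar> powr p \<le> (1 + r / (2 * n)) * \<bar>a\<bar> powr p"
      using n r mult_right_mono[of 1 "1 + r / (2 * n)" "\<bar>a\<bar> powr p"] by simp
    ultimately show ?thesis
      using abs_powr_add_le_derivative_increment[of p a b] p by linarith
  qed
  with p show ?thesis
    unfolding r_def second_order_powr_bound_def by (intro exI[of _ "2 * p"]) auto
next
  case False
  define r where "r = max 1 (p / 2)"
  have p2: "2 < p" and r: "r = p / 2" using False by (auto simp: r_def)
  define D where "D = p * (p - 1) * 2 powr (p - 2)"
  define L where "L = 4 * D / p"
  have D: "0 < D" and L: "0 < L" using p2 by (auto simp: D_def L_def)
  have "1 * 1 \<le> (p - 1) * 2 powr (p - 2)"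
    using p2 ge_one_powr_ge_zero[of 2 "p - 2"] by (intro mult_mono) auto
  then have L1: "1 \<le> L" using p2 by (simp add: L_def D_def)
  have "\<bar>a + b\<bar> powr p \<le> (1 + r / (2 * n)) * \<bar>a\<bar> powr p + p * (sgn a * \<bar>a\<bar> powr (p - 1)) * b
         + D * L powr (r - 1) * n powr (r - 1) * \<bar>b\<bar> powr p" if n: "1 \<le> n" for n a b :: real
  proof -
    \<comment> \<open>The threshold is \<open>|a| / l\<close>; \<open>L\<close> is chosen so that the coefficient \<open>D / l\<^sup>2\<close> equals \<open>r / (2 * n)\<close>.\<close>
    define l where "l = sqrt (L * n)"
    have Ln: "1 * 1 \<le> L * n" using L1 n by (intro mult_mono) auto
    then have l: "1 \<le> l" by (simp add: l_def)
    have l2: "l\<^sup>2 = L * n" using L n by (simp add: l_def)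
    have key: "(\<bar>a\<bar> + \<bar>b\<bar>) powr (p - 2) * b\<^sup>2 \<le>
        2 powr (p - 2) * (\<bar>a\<bar> powr p / l\<^sup>2 + l powr (p - 2) * \<bar>b\<bar> powr p)"
    proof (cases "l * \<bar>b\<bar> \<le> \<bar>a\<bar>")
      case True
      have "1 * \<bar>b\<bar> \<le> l * \<bar>b\<bar>" using l by (intro mult_right_mono) auto
      then have "(\<bar>a\<bar> + \<bar>b\<bar>) powr (p - 2) \<le> (2 * \<bar>a\<bar>) powr (p - 2)"
        using True p2 by (intro powr_mono2) auto
      moreover have "b\<^sup>2 \<le> \<bar>a\<bar>\<^sup>2 / l\<^sup>2"
        using l power_mono[OF True, of 2] by (simp add: power_mult_distrib field_simps)
      ultimately have "(\<bar>a\<bar> + \<bar>b\<bar>) powr (p - 2) * b\<^sup>2 \<le> (2 * \<bar>a\<bar>) powr (p - 2) * (\<bar>a\<bar>\<^sup>2 / l\<^sup>2)"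
        by (intro mult_mono) auto
      also have "\<dots> = 2 powr (p - 2) * (\<bar>a\<bar> powr p / l\<^sup>2)"
        using p2 by (cases "a = 0") (auto simp: powr_mult powr_diff power2_eq_square)
      also have "\<dots> \<le> 2 powr (p - 2) * (\<bar>a\<bar> powr p / l\<^sup>2 + l powr (p - 2) * \<bar>b\<bar> powr p)"
        by (intro mult_left_mono) auto
      finally show ?thesis .
    next
      case False
      have "1 * \<bar>b\<bar> \<le> l * \<bar>b\<bar>" using l by (intro mult_right_mono) auto
      then have "(\<bar>a\<bar> + \<bar>b\<bar>) powr (p - 2) \<le> (2 * (l * \<bar>b\<bar>)) powr (p - 2)"
        using False p2 by (intro powr_mono2) auto
      then have "(\<bar>a\<bar> + \<bar>b\<bar>) powr (p - 2) * b\<^sup>2 \<le> (2 * (l * \<bar>b\<bar>)) powr (p - 2) * \<bar>b\<bar>\<^sup>2"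
        by (intro mult_mono) auto
      also have "\<dots> = 2 powr (p - 2) * (l powr (p - 2) * \<bar>b\<bar> powr p)"
        using p2 l by (cases "b = 0") (auto simp: powr_mult powr_diff power2_eq_square)
      also have "\<dots> \<le> 2 powr (p - 2) * (\<bar>a\<bar> powr p / l\<^sup>2 + l powr (p - 2) * \<bar>b\<bar> powr p)"
        by (intro mult_left_mono) auto
      finally show ?thesis .
    qed
    have "\<bar>sgn (a + b) * \<bar>a + b\<bar> powr (p - 1) - sgn a * \<bar>a\<bar> powr (p - 1)\<bar> * \<bar>b\<bar>
        \<le> (p - 1) * (\<bar>a\<bar> + \<bar>b\<bar>) powr (p - 2) * \<bar>b\<bar> * \<bar>b\<bar>"
      using signed_powr_Lipschitz[of "p - 1" "a + b" "\<bar>a\<bar> + \<bar>b\<bar>" a] p2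
      by (intro mult_right_mono) auto
    also have "\<dots> = (p - 1) * ((\<bar>a\<bar> + \<bar>b\<bar>) powr (p - 2) * b\<^sup>2)"
      by (simp add: power2_eq_square abs_mult_self_eq)
    also have "\<dots> \<le> (p - 1) * (2 powr (p - 2) * (\<bar>a\<bar> powr p / l\<^sup>2 + l powr (p - 2) * \<bar>b\<bar> powr p))"
      using p by (intro mult_left_mono key) auto
    finally have "p * (\<bar>sgn (a + b) * \<bar>a + b\<bar> powr (p - 1) - sgn a * \<bar>a\<bar> powr (p - 1)\<bar> * \<bar>b\<bar>) \<le>
        p * ((p - 1) * (2 powr (p - 2) * (\<bar>a\<bar> powr p / l\<^sup>2 + l powr (p - 2) * \<bar>b\<bar> powr p)))"
      using p by (intro mult_left_mono) auto
    also have "\<dots> = D / l\<^sup>2 * \<bar>a\<bar> powr p + D * l powr (p - 2) * \<bar>b\<bar> powr p"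
      by (simp add: D_def algebra_simps)
    also have "D / l\<^sup>2 = r / (2 * n)"
      unfolding l2 using D n p2 by (simp add: L_def r field_simps)
    also have "l powr (p - 2) = L powr (r - 1) * n powr (r - 1)"
    proof -
      have "l = (L * n) powr (1 / 2)" using Ln by (simp add: l_def powr_half_sqrt)
      then show ?thesis using L n by (simp add: powr_powr powr_mult r diff_divide_distrib)
    qed
    finally show ?thesis
      using abs_powr_add_le_derivative_increment[of p a b] p by (simp add: algebra_simps)
  qed
  with D L show ?thesis
    unfolding r_def second_order_powr_bound_def
    by (intro exI[of _ "D * L powr (max 1 (p / 2) - 1)"]) auto
qed

lemma abs_powr_add_le:
  fixes a b p :: real
  assumes "1 \<le> p"
  shows "\<bar>a + b\<bar> powr p \<le> 2 powr (p - 1) * (\<bar>a\<bar> powr p + \<bar>b\<bar> powr p)"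
proof -
  define c where "c = (\<bar>a\<bar> + \<bar>b\<bar>) / 2"
  have c: "0 \<le> c" by (simp add: c_def)
  have "2 * c powr p = (c powr p + p * c powr (p - 1) * (\<bar>a\<bar> - c)) + (c powr p + p * c powr (p - 1) * (\<bar>b\<bar> - c))"
    by (simp add: c_def algebra_simps)
  also have "\<dots> \<le> \<bar>a\<bar> powr p + \<bar>b\<bar> powr p"
    using assms c by (intro add_mono powr_tangent_le) auto
  finally have "2 powr (p - 1) * (2 * c powr p) \<le> 2 powr (p - 1) * (\<bar>a\<bar> powr p + \<bar>b\<bar> powr p)"
    by (intro mult_left_mono) auto
  also have "2 powr (p - 1) * (2 * c powr p) = (2 * c) powr p"
    using c by (simp add: powr_mult powr_diff)
  also have "2 * c = \<bar>a\<bar> + \<bar>b\<bar>" by (simp add: c_def)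
  finally have "(\<bar>a\<bar> + \<bar>b\<bar>) powr p \<le> 2 powr (p - 1) * (\<bar>a\<bar> powr p + \<bar>b\<bar> powr p)"
    .
  moreover have "\<bar>a + b\<bar> powr p \<le> (\<bar>a\<bar> + \<bar>b\<bar>) powr p"
    using assms by (intro powr_mono2) auto
  ultimately show ?thesis by simp
qed

section \<open>Empirical approximation of a mean in Lp\<close>

lemma abs_le_one_plus_abs_powr:
  fixes x p :: real
  assumes "1 \<le> p"
  shows "\<bar>x\<bar> \<le> 1 + \<bar>x\<bar> powr p"
proof (cases "\<bar>x\<bar> \<le> 1")
  case True
  then show ?thesis using powr_ge_zero[of "\<bar>x\<bar>" p] by linarith
next
  case False
  then have "\<bar>x\<bar> powr 1 \<le> \<bar>x\<bar> powr p" using assms by (intro powr_mono) auto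
  then show ?thesis by simp
qed

lemma integrable_of_integrable_abs_powr:
  fixes W :: "'a \<Rightarrow> real"
  assumes "finite_measure N" and [measurable]: "W \<in> borel_measurable N" and p: "1 \<le> p"
    and int: "integrable N (\<lambda>x. \<bar>W x\<bar> powr p)"
  shows "integrable N W"
proof (rule Bochner_Integration.integrable_bound)
  interpret finite_measure N by fact
  show "integrable N (\<lambda>x. 1 + \<bar>W x\<bar> powr p)"
    using int by simp
  show "AE x in N. norm (W x) \<le> norm (1 + \<bar>W x\<bar> powr p)"
  proof (rule AE_I2)
    fix x
    show "norm (W x) \<le> norm (1 + \<bar>W x\<bar> powr p)"
      using abs_le_one_plus_abs_powr[OF p, of "W x"] by simp
  qed
qed measurable

text \<open>
  Jensen's inequality for a measure of mass at most \<open>k\<close>: integrate the tangent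
  inequality at the point \<open>c\<close> that is the mean of \<open>|W|\<close> when the mass
  equals \<open>k\<close>. If \<open>|W| powr p\<close> is not integrable, the right-hand side is
  infinite.
\<close>

lemma abs_integral_powr_le:
  fixes W :: "'a \<Rightarrow> real"
  assumes N: "finite_measure N" and [measurable]: "W \<in> borel_measurable N"
    and p: "1 < p" and k: "0 < k" "measure N (space N) \<le> k"
  shows "ennreal (\<bar>\<integral>x. W x \<partial>N\<bar> powr p) \<le> ennreal (k powr (p - 1)) * (\<integral>\<^sup>+x. ennreal (\<bar>W x\<bar> powr p) \<partial>N)"
proof (cases "integrable N (\<lambda>x. \<bar>W x\<bar> powr p)")
  case False
  then have "(\<integral>\<^sup>+x. ennreal (\<bar>W x\<bar> powr p) \<partial>N) = \<infinity>"
    unfolding integrable_iff_bounded by (auto simp: less_top[symmetric])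
  moreover have "ennreal (k powr (p - 1)) * \<infinity> = \<infinity>"
    using k by (simp add: ennreal_mult_eq_top_iff)
  ultimately show ?thesis by simp
next
  case True
  interpret finite_measure N by fact
  have W: "integrable N W"
    by (rule integrable_of_integrable_abs_powr[OF N _ _ True]) (use p in auto)
  \<comment> \<open>The tangent point that makes the resulting bound optimal for mass \<open>k\<close>.\<close>
  define c where "c = (\<integral>x. \<bar>W x\<bar> \<partial>N) / k"
  define I where "I = (\<integral>x. \<bar>W x\<bar> powr p \<partial>N)"
  have c: "0 \<le> c" using k by (simp add: c_def)
  have "(\<integral>x. p * c powr (p - 1) * \<bar>W x\<bar> - (p - 1) * c powr p \<partial>N) \<le> I"
    unfolding I_def
  proof (rule integral_mono)
    fix x
    have "c powr p + p * c powr (p - 1) * (\<bar>W x\<bar> - c) \<le> \<bar>W x\<bar> powr p"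
      using p c by (intro powr_tangent_le) auto
    moreover have "p * c powr (p - 1) * (\<bar>W x\<bar> - c) = p * c powr (p - 1) * \<bar>W x\<bar> - p * c powr p"
      using c by (cases "c = 0") (auto simp: powr_diff right_diff_distrib)
    ultimately show "p * c powr (p - 1) * \<bar>W x\<bar> - (p - 1) * c powr p \<le> \<bar>W x\<bar> powr p"
      by (simp add: left_diff_distrib)
  qed (use W True in auto)
  also have "(\<integral>x. p * c powr (p - 1) * \<bar>W x\<bar> - (p - 1) * c powr p \<partial>N)
      = p * (c powr (p - 1) * (c * k)) - (p - 1) * c powr p * measure N (space N)"
    using W k by (simp add: c_def)
  also have "c powr (p - 1) * (c * k) = c powr p * k"
    using c by (cases "c = 0") (auto simp: powr_diff)
  finally have "p * (c powr p * k) - (p - 1) * c powr p * measure N (space N) \<le> I"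
    by (simp add: mult.assoc)
  moreover have "(p - 1) * c powr p * measure N (space N) \<le> (p - 1) * c powr p * k"
    using p k by (intro mult_left_mono) auto
  ultimately have I: "c powr p * k \<le> I" by (simp add: algebra_simps)
  have "(\<integral>x. \<bar>W x\<bar> \<partial>N) powr p = (c * k) powr p"
    using k by (simp add: c_def)
  also have "\<dots> = k powr (p - 1) * (c powr p * k)"
    using k c by (simp add: powr_mult powr_diff)
  also have "\<dots> \<le> k powr (p - 1) * I"
    using I by (intro mult_left_mono) auto
  finally have "(\<integral>x. \<bar>W x\<bar> \<partial>N) powr p \<le> k powr (p - 1) * I" .
  moreover have "\<bar>\<integral>x. W x \<partial>N\<bar> powr p \<le> (\<integral>x. \<bar>W x\<bar> \<partial>N) powr p"
    using p integral_abs_bound[of N W] by (intro powr_mono2) auto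
  ultimately have "\<bar>\<integral>x. W x \<partial>N\<bar> powr p \<le> k powr (p - 1) * I" by linarith
  then have "ennreal (\<bar>\<integral>x. W x \<partial>N\<bar> powr p) \<le> ennreal (k powr (p - 1) * I)"
    by (rule ennreal_leI)
  also have "\<dots> = ennreal (k powr (p - 1)) * ennreal I"
    by (simp add: ennreal_mult I_def)
  also have "ennreal I = (\<integral>\<^sup>+x. ennreal (\<bar>W x\<bar> powr p) \<partial>N)"
    using True by (simp add: I_def nn_integral_eq_integral)
  finally show ?thesis .
qed

lemma exists_le_of_nn_integral_le:
  assumes M: "emeasure M (space M) = 1" and h: "h \<in> borel_measurable M"
    and le: "(\<integral>\<^sup>+i. h i \<partial>M) \<le> ennreal R"
  shows "\<exists>i\<in>space M. h i \<le> ennreal R"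
proof (rule ccontr)
  assume *: "\<not> ?thesis"
  interpret finite_measure M by standard (simp add: M)
  have "(\<integral>\<^sup>+i. ennreal R \<partial>M) < (\<integral>\<^sup>+i. h i \<partial>M)"
  proof (rule nn_integral_less)
    show "AE i in M. ennreal R \<le> h i" using * by (intro AE_I2) (auto simp: not_le intro: less_imp_le)
    show "\<not> (AE i in M. h i \<le> ennreal R)"
    proof
      assume "AE i in M. h i \<le> ennreal R"
      then have "AE i in M. False"
        by (rule AE_mp) (use * in \<open>auto intro!: AE_I2\<close>)
      then show False
        using M by (simp add: trivial_limit_def[symmetric] ae_filter_eq_bot_iff)
    qed
  qed (use h M in \<open>auto simp: ennreal_mult_eq_top_iff\<close>)
  then show False using le M by simp
qed

text \<open>
  Averaging a second-order bound over \<open>i\<close> with \<open>b = u i - \<integral>u\<close>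
  removes the linear term. Jensen's inequality bounds the \<open>p\<close>-th moment of the centred
  variable by \<open>2 powr p\<close> times that of \<open>u\<close>.
\<close>

lemma mean_abs_powr_shift_le:
  fixes u :: "'i \<Rightarrow> real" and s p \<alpha> \<beta> :: real
  assumes M: "emeasure M (space M) = 1" and [measurable]: "u \<in> borel_measurable M"
    and p: "1 < p" and ab: "0 \<le> \<alpha>" "0 \<le> \<beta>"
    and fin: "(\<integral>\<^sup>+i. ennreal (\<bar>u i\<bar> powr p) \<partial>M) < \<infinity>"
    and ineq: "\<And>a b. \<bar>a + b\<bar> powr p \<le> \<alpha> * \<bar>a\<bar> powr p + p * (sgn a * \<bar>a\<bar> powr (p - 1)) * b + \<beta> * \<bar>b\<bar> powr p"
  shows "(\<integral>\<^sup>+i. ennreal (\<bar>s + (u i - (\<integral>i. u i \<partial>M))\<bar> powr p) \<partial>M)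
    \<le> ennreal (\<alpha> * \<bar>s\<bar> powr p) + ennreal (\<beta> * 2 powr p) * (\<integral>\<^sup>+i. ennreal (\<bar>u i\<bar> powr p) \<partial>M)"
proof -
  interpret finite_measure M by standard (simp add: M)
  have m1: "measure M (space M) = 1" by (simp add: measure_def M)
  define g where "g = (\<integral>i. u i \<partial>M)"
  define I where "I = (\<integral>i. \<bar>u i\<bar> powr p \<partial>M)"
  have up: "integrable M (\<lambda>i. \<bar>u i\<bar> powr p)"
    using fin by (simp add: integrable_iff_bounded)
  have I: "(\<integral>\<^sup>+i. ennreal (\<bar>u i\<bar> powr p) \<partial>M) = ennreal I"
    using up by (simp add: I_def nn_integral_eq_integral)
  have u: "integrable M u"
    by (rule integrable_of_integrable_abs_powr[OF finite_measure_axioms _ _ up]) (use p in auto)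
  have I0: "0 \<le> I" by (simp add: I_def)
  have "ennreal (\<bar>g\<bar> powr p) \<le> ennreal I"
    using abs_integral_powr_le[OF finite_measure_axioms, of u p 1] p m1 by (simp add: I g_def)
  then have gI: "\<bar>g\<bar> powr p \<le> I" using I0 by simp
  define B where "B = (\<lambda>i. 2 powr (p - 1) * (\<bar>u i\<bar> powr p + \<bar>g\<bar> powr p))"
  have Y: "\<bar>u i - g\<bar> powr p \<le> B i" for i
    using abs_powr_add_le[of p "u i" "- g"] p by (simp add: B_def)
  have Bint: "integrable M B" unfolding B_def using up by simp
  define R where "R = (\<lambda>i. \<alpha> * \<bar>s\<bar> powr p + p * (sgn s * \<bar>s\<bar> powr (p - 1)) * (u i - g) + \<beta> * B i)"
  have R: "\<bar>s + (u i - g)\<bar> powr p \<le> R i" for i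
    using ineq[of s "u i - g"] mult_left_mono[OF Y ab(2), of i] by (simp add: R_def)
  have Rint: "integrable M R" unfolding R_def using u Bint by simp
  have "(\<integral>\<^sup>+i. ennreal (\<bar>s + (u i - g)\<bar> powr p) \<partial>M) \<le> (\<integral>\<^sup>+i. ennreal (R i) \<partial>M)"
    using R by (intro nn_integral_mono ennreal_leI) auto
  also have "\<dots> = ennreal (\<integral>i. R i \<partial>M)"
    using R by (intro nn_integral_eq_integral Rint AE_I2) (meson order_trans powr_ge_zero)
  also have "(\<integral>i. R i \<partial>M) = \<alpha> * \<bar>s\<bar> powr p + \<beta> * (2 powr (p - 1) * (I + \<bar>g\<bar> powr p))"
    unfolding R_def B_def using u up m1 by (simp add: g_def I_def)
  also have "\<dots> \<le> \<alpha> * \<bar>s\<bar> powr p + \<beta> * (2 powr (p - 1) * (I + I))"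
    using ab gI by (intro add_left_mono mult_left_mono) auto
  also have "\<dots> = \<alpha> * \<bar>s\<bar> powr p + \<beta> * 2 powr p * I"
    by (simp add: powr_diff)
  finally have "(\<integral>\<^sup>+i. ennreal (\<bar>s + (u i - g)\<bar> powr p) \<partial>M) \<le> ennreal (\<alpha> * \<bar>s\<bar> powr p + \<beta> * 2 powr p * I)"
    by (simp add: ennreal_leI)
  also have "\<dots> = ennreal (\<alpha> * \<bar>s\<bar> powr p) + ennreal (\<beta> * 2 powr p) * ennreal I"
    using ab I0 by (simp add: ennreal_plus ennreal_mult)
  finally show ?thesis by (simp add: I g_def)
qed

text \<open>
  By Tonelli's theorem the average over \<open>i\<close> of the integrals on the left can be
  computed pointwise in \<open>x\<close>, where the preceding bound applies. Some \<open>i\<close>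
  does not exceed the average.
\<close>

lemma greedy_step:
  fixes u :: "'i \<Rightarrow> 'x \<Rightarrow> real" and S :: "'x \<Rightarrow> real" and p \<alpha> \<beta> A B :: real
  assumes M: "emeasure M (space M) = 1" and N: "sigma_finite_measure N"
    and u[measurable]: "(\<lambda>(i, x). u i x) \<in> borel_measurable (M \<Otimes>\<^sub>M N)"
    and S[measurable]: "S \<in> borel_measurable N"
    and p: "1 < p" and nonneg: "0 \<le> \<alpha>" "0 \<le> \<beta>" "0 \<le> A" "0 \<le> B"
    and B: "(\<integral>\<^sup>+x. \<integral>\<^sup>+i. ennreal (\<bar>u i x\<bar> powr p) \<partial>M \<partial>N) \<le> ennreal B"
    and A: "(\<integral>\<^sup>+x. ennreal (\<bar>S x\<bar> powr p) \<partial>N) \<le> ennreal A"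
    and ineq: "\<And>a b. \<bar>a + b\<bar> powr p \<le> \<alpha> * \<bar>a\<bar> powr p + p * (sgn a * \<bar>a\<bar> powr (p - 1)) * b + \<beta> * \<bar>b\<bar> powr p"
  shows "\<exists>i\<in>space M. (\<integral>\<^sup>+x. ennreal (\<bar>S x + (u i x - (\<integral>i. u i x \<partial>M))\<bar> powr p) \<partial>N)
    \<le> ennreal (\<alpha> * A + \<beta> * 2 powr p * B)"
proof -
  interpret M: finite_measure M by standard (simp add: M)
  interpret N: sigma_finite_measure N by fact
  interpret P: pair_sigma_finite M N ..
  define g where "g = (\<lambda>x. \<integral>i. u i x \<partial>M)"
  have u'[measurable]: "(\<lambda>(x, i). u i x) \<in> borel_measurable (N \<Otimes>\<^sub>M M)"
    using measurable_pair_swap[OF u] by (simp add: case_prod_beta')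
  have g[measurable]: "g \<in> borel_measurable N"
    unfolding g_def by measurable
  define h where "h = (\<lambda>i. \<integral>\<^sup>+x. ennreal (\<bar>S x + (u i x - g x)\<bar> powr p) \<partial>N)"
  have "(\<integral>\<^sup>+i. h i \<partial>M) = (\<integral>\<^sup>+x. \<integral>\<^sup>+i. ennreal (\<bar>S x + (u i x - g x)\<bar> powr p) \<partial>M \<partial>N)"
    unfolding h_def by (rule P.Fubini'[symmetric]) measurable
  also have "\<dots> \<le> (\<integral>\<^sup>+x. ennreal \<alpha> * ennreal (\<bar>S x\<bar> powr p)
        + ennreal (\<beta> * 2 powr p) * (\<integral>\<^sup>+i. ennreal (\<bar>u i x\<bar> powr p) \<partial>M) \<partial>N)"
  proof (rule nn_integral_mono_AE)
    have "(\<integral>\<^sup>+x. \<integral>\<^sup>+i. ennreal (\<bar>u i x\<bar> powr p) \<partial>M \<partial>N) \<noteq> \<infinity>"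
      using B by (auto simp: top_unique)
    then have "AE x in N. (\<integral>\<^sup>+i. ennreal (\<bar>u i x\<bar> powr p) \<partial>M) \<noteq> \<infinity>"
      by (intro nn_integral_PInf_AE) measurable
    then show "AE x in N. (\<integral>\<^sup>+i. ennreal (\<bar>S x + (u i x - g x)\<bar> powr p) \<partial>M)
        \<le> ennreal \<alpha> * ennreal (\<bar>S x\<bar> powr p) + ennreal (\<beta> * 2 powr p) * (\<integral>\<^sup>+i. ennreal (\<bar>u i x\<bar> powr p) \<partial>M)"
    proof (rule AE_mp, intro AE_I2 impI)
      fix x assume x: "x \<in> space N" and "(\<integral>\<^sup>+i. ennreal (\<bar>u i x\<bar> powr p) \<partial>M) \<noteq> \<infinity>"
      then have fin: "(\<integral>\<^sup>+i. ennreal (\<bar>u i x\<bar> powr p) \<partial>M) < \<infinity>" by (simp add: less_top)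
      have [measurable]: "(\<lambda>i. u i x) \<in> borel_measurable M"
        using measurable_Pair2[OF u' x] by simp
      show "(\<integral>\<^sup>+i. ennreal (\<bar>S x + (u i x - g x)\<bar> powr p) \<partial>M)
        \<le> ennreal \<alpha> * ennreal (\<bar>S x\<bar> powr p) + ennreal (\<beta> * 2 powr p) * (\<integral>\<^sup>+i. ennreal (\<bar>u i x\<bar> powr p) \<partial>M)"
        using mean_abs_powr_shift_le[OF M _ p nonneg(1,2) fin ineq, of "S x"] nonneg
        by (simp add: g_def ennreal_mult)
    qed
  qed
  also have "\<dots> = ennreal \<alpha> * (\<integral>\<^sup>+x. ennreal (\<bar>S x\<bar> powr p) \<partial>N)
      + ennreal (\<beta> * 2 powr p) * (\<integral>\<^sup>+x. \<integral>\<^sup>+i. ennreal (\<bar>u i x\<bar> powr p) \<partial>M \<partial>N)"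
    by (simp add: nn_integral_add nn_integral_cmult)
  also have "\<dots> \<le> ennreal \<alpha> * ennreal A + ennreal (\<beta> * 2 powr p) * ennreal B"
    using A B by (intro add_mono mult_left_mono) auto
  also have "\<dots> = ennreal (\<alpha> * A + \<beta> * 2 powr p * B)"
    using nonneg by (simp add: ennreal_plus ennreal_mult)
  finally have "(\<integral>\<^sup>+i. h i \<partial>M) \<le> ennreal (\<alpha> * A + \<beta> * 2 powr p * B)" .
  moreover have "h \<in> borel_measurable M" unfolding h_def by measurable
  ultimately show ?thesis
    using exists_le_of_nn_integral_le[OF M] unfolding h_def g_def by blast
qed

text \<open>
  A mean of functions is approximated in \<open>L\<^sub>p\<close> by an average of \<open>m\<close>
  of them; the order in \<open>m\<close> is that of the law of large numbers in a space of type
  \<open>min p 2\<close>. The greedy choice of the indices takes the place of an independent sample.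
\<close>

lemma Lp_empirical_approximation:
  fixes u :: "'i \<Rightarrow> 'x \<Rightarrow> real" and p B C :: real and m :: nat
  assumes p: "1 < p" and C': "second_order_powr_bound p C"
    and M: "emeasure M (space M) = 1" and N: "sigma_finite_measure N"
    and u: "(\<lambda>(i, x). u i x) \<in> borel_measurable (M \<Otimes>\<^sub>M N)" and B0: "0 \<le> B"
    and B: "(\<integral>\<^sup>+x. \<integral>\<^sup>+i. ennreal (\<bar>u i x\<bar> powr p) \<partial>M \<partial>N) \<le> ennreal B" and m: "0 < m"
  shows "\<exists>i. (\<forall>j. i j \<in> space M) \<and>
    (\<integral>\<^sup>+x. ennreal (\<bar>(\<Sum>j<m. u (i j) x) / real m - (\<integral>i. u i x \<partial>M)\<bar> powr p) \<partial>N)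
      \<le> ennreal (2 * C * 2 powr p * B * real m powr (max 1 (p / 2) - p))"
proof -
  define r where "r = max 1 (p / 2)"
  have r: "1 \<le> r" by (simp add: r_def)
  have C: "0 \<le> C"
    and ineq: "\<And>n a b :: real. 1 \<le> n \<Longrightarrow>
       \<bar>a + b\<bar> powr p \<le> (1 + r / (2 * n)) * \<bar>a\<bar> powr p + p * (sgn a * \<bar>a\<bar> powr (p - 1)) * b
         + C * n powr (r - 1) * \<bar>b\<bar> powr p"
    using C' unfolding second_order_powr_bound_def r_def by auto
  interpret M: finite_measure M by standard (simp add: M)
  interpret N: sigma_finite_measure N by fact
  define g where "g = (\<lambda>x. \<integral>i. u i x \<partial>M)"
  define K where "K = 2 * C * 2 powr p * B"
  have K: "0 \<le> K" using C B0 by (simp add: K_def)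
  have u'[measurable]: "(\<lambda>(x, i). u i x) \<in> borel_measurable (N \<Otimes>\<^sub>M M)"
    using measurable_pair_swap[OF u] by (simp add: case_prod_beta')
  have g[measurable]: "g \<in> borel_measurable N"
    unfolding g_def by measurable
  have ui: "u i \<in> borel_measurable N" if "i \<in> space M" for i
    using measurable_Pair2[OF u that] by simp
  have step: "\<exists>i. (\<forall>j. i j \<in> space M) \<and>
      (\<integral>\<^sup>+x. ennreal (\<bar>\<Sum>j<n. u (i j) x - g x\<bar> powr p) \<partial>N) \<le> ennreal (K * real n powr r)" for n
  proof (induction n)
    case 0
    have "space M \<noteq> {}" using M by auto
    then show ?case using p by auto
  next
    case (Suc n)
    then obtain i where i: "\<And>j. i j \<in> space M"
      and IH: "(\<integral>\<^sup>+x. ennreal (\<bar>\<Sum>j<n. u (i j) x - g x\<bar> powr p) \<partial>N) \<le> ennreal (K * real n powr r)"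
      by blast
    have meas: "(\<lambda>x. \<Sum>j<n. u (i j) x - g x) \<in> borel_measurable N"
      using ui[OF i] g by measurable
    \<comment> \<open>In the first step the partial sum is zero and the coefficient in front of it is irrelevant, so \<open>k = 1\<close> will do for \<open>n = 0\<close>.\<close>
    define k where "k = max 1 (real n)"
    have k: "1 \<le> k" by (simp add: k_def)
    have "0 \<le> 1 + r / (2 * k)" "0 \<le> C * k powr (r - 1)" using r k C by auto
    then have "\<exists>i'\<in>space M. (\<integral>\<^sup>+x. ennreal (\<bar>(\<Sum>j<n. u (i j) x - g x) + (u i' x - g x)\<bar> powr p) \<partial>N)
        \<le> ennreal ((1 + r / (2 * k)) * (K * real n powr r) + C * k powr (r - 1) * 2 powr p * B)"
      unfolding g_def
      by (rule greedy_step[OF M N u meas[unfolded g_def] p _ _ _ B0 B IH[unfolded g_def] ineq[OF k]])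
        (use K in auto)
    then obtain i' where i': "i' \<in> space M"
      and le: "(\<integral>\<^sup>+x. ennreal (\<bar>(\<Sum>j<n. u (i j) x - g x) + (u i' x - g x)\<bar> powr p) \<partial>N)
        \<le> ennreal ((1 + r / (2 * k)) * (K * real n powr r) + C * k powr (r - 1) * 2 powr p * B)"
      by blast
    have "(1 + r / (2 * k)) * (K * real n powr r) + C * k powr (r - 1) * 2 powr p * B
        \<le> K * real (Suc n) powr r"
    proof (cases "n = 0")
      case True
      have "C * 2 powr p * B \<le> 2 * (C * 2 powr p * B)" using C B0 by simp
      moreover have "k = 1" using True by (simp add: k_def)
      ultimately show ?thesis using True by (simp add: K_def)
    next
      case False
      then have kn: "k = real n" and n: "0 < real n" by (auto simp: k_def)
      have nr: "real n powr r = real n powr (r - 1) * real n"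
        using n by (simp add: powr_diff)
      have "C * 2 powr p * B \<le> K * r / 2"
        using r mult_left_mono[of 1 r "C * 2 powr p * B"] C B0 by (simp add: K_def)
      then have "C * 2 powr p * B * real n powr (r - 1) \<le> K * r / 2 * real n powr (r - 1)"
        by (intro mult_right_mono) auto
      moreover have "(1 + r / (2 * real n)) * (K * (real n powr (r - 1) * real n))
          + C * real n powr (r - 1) * 2 powr p * B
        = K * (real n powr (r - 1) * real n) + K * r / 2 * real n powr (r - 1)
          + C * 2 powr p * B * real n powr (r - 1)"
        using n by (simp add: divide_simps) (simp add: algebra_simps)
      ultimately have "(1 + r / (2 * k)) * (K * real n powr r) + C * k powr (r - 1) * 2 powr p * B
        \<le> K * (real n powr (r - 1) * real n) + K * r / 2 * real n powr (r - 1)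
          + K * r / 2 * real n powr (r - 1)"
        unfolding kn nr by linarith
      also have "\<dots> = K * (real n powr r + r * real n powr (r - 1) * (real (Suc n) - real n))"
        unfolding nr by (simp add: algebra_simps)
      also have "\<dots> \<le> K * real (Suc n) powr r"
        using r K by (intro mult_left_mono powr_tangent_le) auto
      finally show ?thesis .
    qed
    with le have le': "(\<integral>\<^sup>+x. ennreal (\<bar>(\<Sum>j<n. u (i j) x - g x) + (u i' x - g x)\<bar> powr p) \<partial>N)
        \<le> ennreal (K * real (Suc n) powr r)"
      by (meson ennreal_leI order_trans)
    have "(\<Sum>j<Suc n. u ((i(n := i')) j) x - g x) = (\<Sum>j<n. u (i j) x - g x) + (u i' x - g x)" for x
      by (simp add: sum.lessThan_Suc)
    with le' i i' show ?case by (intro exI[of _ "i(n := i')"]) auto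
  qed
  obtain i where i: "\<And>j. i j \<in> space M"
      and *: "(\<integral>\<^sup>+x. ennreal (\<bar>\<Sum>j<m. u (i j) x - g x\<bar> powr p) \<partial>N) \<le> ennreal (K * real m powr r)"
    using step[of m] by blast
  have [measurable]: "(\<lambda>x. \<Sum>j<m. u (i j) x - g x) \<in> borel_measurable N"
      using ui[OF i] g by measurable
  have "ennreal (\<bar>(\<Sum>j<m. u (i j) x) / real m - g x\<bar> powr p)
      = ennreal (real m powr - p) * ennreal (\<bar>\<Sum>j<m. u (i j) x - g x\<bar> powr p)" for x
  proof -
    have "(\<Sum>j<m. u (i j) x) / real m - g x = (\<Sum>j<m. u (i j) x - g x) / real m"
      using m by (simp add: sum_subtractf field_simps)
    then show ?thesis
      using m by (simp add: abs_divide powr_divide powr_minus flip: ennreal_mult)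
        (simp add: divide_inverse mult.commute)
  qed
  then have "(\<integral>\<^sup>+x. ennreal (\<bar>(\<Sum>j<m. u (i j) x) / real m - g x\<bar> powr p) \<partial>N)
      = ennreal (real m powr - p) * (\<integral>\<^sup>+x. ennreal (\<bar>\<Sum>j<m. u (i j) x - g x\<bar> powr p) \<partial>N)"
    by (simp add: nn_integral_cmult)
  also have "\<dots> \<le> ennreal (real m powr - p) * ennreal (K * real m powr r)"
    using * by (intro mult_left_mono) auto
  also have "\<dots> = ennreal (real m powr - p * (K * real m powr r))"
    using K by (simp add: ennreal_mult)
  also have "real m powr - p * (K * real m powr r) = K * real m powr (r - p)"
    by (simp add: powr_diff powr_minus divide_inverse)
  finally show ?thesis using i unfolding g_def K_def r_def by blast
qed

section \<open>Translations and fractional smoothness\<close>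

lemma nn_integral_lborel_affine:
  fixes f :: "'a::euclidean_space \<Rightarrow> ennreal"
  assumes [measurable]: "f \<in> borel_measurable borel" and c: "c \<noteq> 0"
  shows "(\<integral>\<^sup>+x. f x \<partial>lborel) = ennreal (\<bar>c\<bar> ^ DIM('a)) * (\<integral>\<^sup>+x. f (t + c *\<^sub>R x) \<partial>lborel)"
  by (subst lborel_affine[OF c, of t])
    (simp add: nn_integral_density nn_integral_distr nn_integral_cmult)

lemma nn_integral_lborel_plus:
  fixes f :: "'a::euclidean_space \<Rightarrow> ennreal"
  assumes [measurable]: "f \<in> borel_measurable borel"
  shows "(\<integral>\<^sup>+x. f (x + t) \<partial>lborel) = (\<integral>\<^sup>+x. f x \<partial>lborel)"
  using nn_integral_lborel_affine[of f 1 t] by (simp add: add.commute)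

lemma nn_integral_lborel_minus:
  fixes f :: "'a::euclidean_space \<Rightarrow> ennreal"
  assumes [measurable]: "f \<in> borel_measurable borel"
  shows "(\<integral>\<^sup>+x. f (x - t) \<partial>lborel) = (\<integral>\<^sup>+x. f x \<partial>lborel)"
  using nn_integral_lborel_plus[of f "- t"] by simp

lemma nn_integral_lborel_reflect:
  fixes f :: "'a::euclidean_space \<Rightarrow> ennreal"
  assumes [measurable]: "f \<in> borel_measurable borel"
  shows "(\<integral>\<^sup>+x. f (t - x) \<partial>lborel) = (\<integral>\<^sup>+x. f x \<partial>lborel)"
  using nn_integral_lborel_affine[of f "- 1" t] by simp

lemma lborel_integral_reflect:
  fixes f :: "'a::euclidean_space \<Rightarrow> real"
  assumes [measurable]: "f \<in> borel_measurable borel"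
  shows "(\<integral>x. f (t - x) \<partial>lborel) = (\<integral>x. f x \<partial>lborel)"
proof -
  have "(\<integral>x. f x \<partial>lborel) = (\<integral>x. f x \<partial>density (distr lborel borel (\<lambda>x. t + (- 1) *\<^sub>R x)) (\<lambda>_. ennreal (\<bar>- 1\<bar> ^ DIM('a))))"
    by (subst lborel_affine[of "- 1" t, symmetric]) auto
  also have "\<dots> = (\<integral>x. f (t - x) \<partial>lborel)"
    by (simp add: density_1 integral_distr)
  finally show ?thesis ..
qed

lemma lborel_integral_plus:
  fixes f :: "'a::euclidean_space \<Rightarrow> real"
  assumes [measurable]: "f \<in> borel_measurable borel"
  shows "(\<integral>x. f (x + t) \<partial>lborel) = (\<integral>x. f x \<partial>lborel)"
proof -
  have "(\<integral>x. f x \<partial>lborel) = (\<integral>x. f x \<partial>distr lborel borel ((+) t))"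
    by (simp add: lborel_distr_plus)
  also have "\<dots> = (\<integral>x. f (x + t) \<partial>lborel)"
    by (simp add: integral_distr add.commute)
  finally show ?thesis ..
qed

definition translation_energy :: "real \<Rightarrow> ('a::euclidean_space \<Rightarrow> real) \<Rightarrow> 'a \<Rightarrow> ennreal" where
  "translation_energy p f z = (\<integral>\<^sup>+x. ennreal (\<bar>f (x - z) - f x\<bar> powr p) \<partial>lborel)"

lemma borel_measurable_translation_energy [measurable]:
  assumes [measurable]: "f \<in> borel_measurable borel"
  shows "translation_energy p f \<in> borel_measurable borel"
  unfolding translation_energy_def by measurable

lemma translation_energy_split:
  fixes f :: "'a::euclidean_space \<Rightarrow> real"
  assumes [measurable]: "f \<in> borel_measurable borel" and p: "1 \<le> p"
  shows "translation_energy p f z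
    \<le> ennreal (2 powr (p - 1)) * (translation_energy p f w + translation_energy p f (z - w))"
proof -
  have "translation_energy p f z \<le> (\<integral>\<^sup>+x. ennreal (2 powr (p - 1)) *
      (ennreal (\<bar>f (x - w) - f x\<bar> powr p) + ennreal (\<bar>f ((x - w) - (z - w)) - f (x - w)\<bar> powr p)) \<partial>lborel)"
    unfolding translation_energy_def
  proof (rule nn_integral_mono)
    fix x
    show "ennreal (\<bar>f (x - z) - f x\<bar> powr p) \<le> ennreal (2 powr (p - 1)) *
      (ennreal (\<bar>f (x - w) - f x\<bar> powr p) + ennreal (\<bar>f ((x - w) - (z - w)) - f (x - w)\<bar> powr p))"
      using abs_powr_add_le[OF p, of "f (x - w) - f x" "f (x - z) - f (x - w)"]
      by (simp flip: ennreal_plus ennreal_mult)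
  qed
  also have "\<dots> = ennreal (2 powr (p - 1)) * ((\<integral>\<^sup>+x. ennreal (\<bar>f (x - w) - f x\<bar> powr p) \<partial>lborel)
     + (\<integral>\<^sup>+x. ennreal (\<bar>f ((x - w) - (z - w)) - f (x - w)\<bar> powr p) \<partial>lborel))"
    by (simp add: nn_integral_cmult nn_integral_add)
  also have "(\<integral>\<^sup>+x. ennreal (\<bar>f ((x - w) - (z - w)) - f (x - w)\<bar> powr p) \<partial>lborel)
      = translation_energy p f (z - w)"
    unfolding translation_energy_def
    by (rule nn_integral_lborel_minus[where f="\<lambda>x. ennreal (\<bar>f (x - (z - w)) - f x\<bar> powr p)"]) measurable
  finally show ?thesis by (simp add: translation_energy_def)
qed

text \<open>
  With \<open>k z = 1 / norm z powr (d + s * p)\<close> the right-hand side is the Slobodeckij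
  integral.
\<close>

lemma nn_integral_translation_energy_weighted:
  fixes f :: "'a::euclidean_space \<Rightarrow> real" and k :: "'a \<Rightarrow> real"
  assumes [measurable]: "f \<in> borel_measurable borel" "k \<in> borel_measurable borel"
    and k: "\<And>z. 0 \<le> k z"
  shows "(\<integral>\<^sup>+z. ennreal (k z) * translation_energy p f z \<partial>lborel)
    = (\<integral>\<^sup>+x. \<integral>\<^sup>+y. ennreal (k (x - y) * \<bar>f x - f y\<bar> powr p) \<partial>lborel \<partial>lborel)"
proof -
  have "(\<integral>\<^sup>+z. ennreal (k z) * translation_energy p f z \<partial>lborel)
     = (\<integral>\<^sup>+z. \<integral>\<^sup>+x. ennreal (k z * \<bar>f x - f (x - z)\<bar> powr p) \<partial>lborel \<partial>lborel)"
    unfolding translation_energy_def using k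
    by (simp add: nn_integral_cmult[symmetric] ennreal_mult abs_minus_commute)
  also have "\<dots> = (\<integral>\<^sup>+x. \<integral>\<^sup>+z. ennreal (k z * \<bar>f x - f (x - z)\<bar> powr p) \<partial>lborel \<partial>lborel)"
    by (rule lborel_pair.Fubini') measurable
  also have "\<dots> = (\<integral>\<^sup>+x. \<integral>\<^sup>+y. ennreal (k (x - y) * \<bar>f x - f y\<bar> powr p) \<partial>lborel \<partial>lborel)"
  proof (rule nn_integral_cong)
    fix x
    show "(\<integral>\<^sup>+z. ennreal (k z * \<bar>f x - f (x - z)\<bar> powr p) \<partial>lborel)
      = (\<integral>\<^sup>+y. ennreal (k (x - y) * \<bar>f x - f y\<bar> powr p) \<partial>lborel)"
      using nn_integral_lborel_reflect[of "\<lambda>y. ennreal (k (x - y) * \<bar>f x - f y\<bar> powr p)" x] by simp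
  qed
  finally show ?thesis .
qed

text \<open>
  Average the splitting \<open>z = w + (z - w)\<close> over \<open>w\<close> in the ball with the
  segment from \<open>0\<close> to \<open>z\<close> as a diameter. The ball is invariant under
  \<open>w \<mapsto> z - w\<close>, and \<open>norm w \<le> norm z\<close> on it, so that the weight
  \<open>1 / norm w powr (d + s * p)\<close> is bounded below there.
\<close>

lemma translation_energy_le_slobodeckij:
  fixes f :: "real ^ 'd \<Rightarrow> real"
  assumes [measurable]: "f \<in> borel_measurable borel" and p: "1 \<le> p" and s: "0 < s"
  shows "translation_energy p f z
    \<le> ennreal (2 powr p * 2 ^ CARD('d) / unit_ball_vol (real CARD('d)) * norm z powr (s * p)) *
      (\<integral>\<^sup>+x. \<integral>\<^sup>+y. ennreal (\<bar>f x - f y\<bar> powr p / norm (x - y) powr (real CARD('d) + s * p)) \<partial>lborel \<partial>lborel)"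
proof (cases "z = 0")
  case True
  then show ?thesis using p by (simp add: translation_energy_def)
next
  case False
  define e where "e = real CARD('d) + s * p"
  define T where "T = (\<integral>\<^sup>+x. \<integral>\<^sup>+y. ennreal (\<bar>f x - f y\<bar> powr p / norm (x - y) powr e) \<partial>lborel \<partial>lborel)"
  define W where "W = translation_energy p f"
  have W[measurable]: "W \<in> borel_measurable borel" by (simp add: W_def)
  define V where "V = unit_ball_vol (real CARD('d)) * (norm z / 2) ^ CARD('d)"
  \<comment> \<open>An open ball, so that it does not contain the singularity \<open>w = 0\<close> of the weight.\<close>
  define B where "B = ball ((1/2) *\<^sub>R z) (norm z / 2)"
  have [measurable]: "B \<in> sets borel" by (simp add: B_def)
  have V: "emeasure lborel B = ennreal V" "0 < V"
    using False by (auto simp: B_def V_def emeasure_ball)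
  have e: "0 \<le> e" using p s by (simp add: e_def)
  have refl: "z - w \<in> B \<longleftrightarrow> w \<in> B" for w
  proof -
    have "(1/2) *\<^sub>R z - (z - w) = - ((1/2) *\<^sub>R z - w)"
      by (simp add: algebra_simps flip: scaleR_2)
    then have "dist ((1/2) *\<^sub>R z) (z - w) = dist ((1/2) *\<^sub>R z) w"
      unfolding dist_norm by (metis norm_minus_cancel)
    then show ?thesis by (simp add: B_def)
  qed
  have near: "norm w \<le> norm z" "w \<noteq> 0" if "w \<in> B" for w
  proof -
    have "norm w \<le> norm ((1/2) *\<^sub>R z) + norm (w - (1/2) *\<^sub>R z)"
      using norm_triangle_ineq[of "(1/2) *\<^sub>R z" "w - (1/2) *\<^sub>R z"] by simp
    then show "norm w \<le> norm z" using that by (simp add: B_def dist_norm norm_minus_commute)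
    show "w \<noteq> 0" using that by (auto simp: B_def)
  qed
  have "ennreal V * W z = (\<integral>\<^sup>+w. W z * indicator B w \<partial>lborel)"
    by (simp add: nn_integral_cmult V mult.commute)
  also have "\<dots> \<le> (\<integral>\<^sup>+w. ennreal (2 powr (p - 1)) * (W w * indicator B w + W (z - w) * indicator B (z - w)) \<partial>lborel)"
    using translation_energy_split[of f p z] p
    by (intro nn_integral_mono) (auto simp: W_def refl split: split_indicator)
  also have "\<dots> = ennreal (2 powr (p - 1)) * ((\<integral>\<^sup>+w. W w * indicator B w \<partial>lborel)
      + (\<integral>\<^sup>+w. W (z - w) * indicator B (z - w) \<partial>lborel))"
    by (simp add: nn_integral_cmult nn_integral_add)
  also have "(\<integral>\<^sup>+w. W (z - w) * indicator B (z - w) \<partial>lborel) = (\<integral>\<^sup>+w. W w * indicator B w \<partial>lborel)"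
    by (rule nn_integral_lborel_reflect[where f="\<lambda>w. W w * indicator B w"]) measurable
  also have "ennreal (2 powr (p - 1)) * ((\<integral>\<^sup>+w. W w * indicator B w \<partial>lborel) + (\<integral>\<^sup>+w. W w * indicator B w \<partial>lborel))
     = ennreal (2 powr p) * (\<integral>\<^sup>+w. W w * indicator B w \<partial>lborel)"
  proof -
    have "ennreal (2 powr p) = ennreal (2 powr (p - 1)) * 2"
      using ennreal_mult[of "2 powr (p - 1)" 2] by (simp add: powr_diff)
    then show ?thesis by (simp add: mult.assoc mult_2)
  qed
  also have "(\<integral>\<^sup>+w. W w * indicator B w \<partial>lborel)
      \<le> (\<integral>\<^sup>+w. ennreal (norm z powr e) * (ennreal (1 / norm w powr e) * W w) \<partial>lborel)"
  proof (rule nn_integral_mono)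
    fix w
    show "W w * indicator B w \<le> ennreal (norm z powr e) * (ennreal (1 / norm w powr e) * W w)"
    proof (cases "w \<in> B")
      case True
      have "1 \<le> norm z powr e * (1 / norm w powr e)"
        using near[OF True] e powr_mono2[of e "norm w" "norm z"] by simp
      then have "1 * W w \<le> ennreal (norm z powr e * (1 / norm w powr e)) * W w"
        by (intro mult_right_mono) (simp_all add: ennreal_ge_1)
      also have "ennreal (norm z powr e * (1 / norm w powr e)) * W w
          = ennreal (norm z powr e) * (ennreal (1 / norm w powr e) * W w)"
        by (subst ennreal_mult) (simp_all add: mult.assoc)
      finally show ?thesis using True by simp
    qed simp
  qed
  also have "\<dots> = ennreal (norm z powr e) * (\<integral>\<^sup>+w. ennreal (1 / norm w powr e) * W w \<partial>lborel)"
    by (simp add: nn_integral_cmult)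
  also have "(\<integral>\<^sup>+w. ennreal (1 / norm w powr e) * W w \<partial>lborel) = T"
    unfolding W_def T_def by (subst nn_integral_translation_energy_weighted) auto
  finally have le: "ennreal V * W z \<le> ennreal (2 powr p) * (ennreal (norm z powr e) * T)"
    by (simp add: mult_left_mono)
  define c where "c = 1 / V"
  have c: "0 \<le> c" "c * V = 1" using V by (auto simp: c_def)
  have "W z = ennreal c * (ennreal V * W z)"
    using V c by (simp flip: mult.assoc ennreal_mult)
  also have "\<dots> \<le> ennreal c * (ennreal (2 powr p) * (ennreal (norm z powr e) * T))"
    using le by (intro mult_left_mono) auto
  also have "\<dots> = ennreal (c * 2 powr p * norm z powr e) * T"
    using c by (simp add: ennreal_mult mult.assoc)
  also have "c * 2 powr p * norm z powr e
     = 2 powr p * 2 ^ CARD('d) / unit_ball_vol (real CARD('d)) * norm z powr (s * p)"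
    using False by (simp add: c_def V_def e_def powr_add powr_realpow power_divide)
  finally show ?thesis by (simp add: W_def T_def e_def)
qed

section \<open>Mixtures at a fixed scale\<close>

text \<open>
  The hypothesis gives only the moment of order \<open>s\<close> of \<open>\<phi>\<close>, not the
  one of order \<open>s * p\<close> that Jensen's inequality for the weight \<open>\<phi>\<close>
  would call for. The weight \<open>norm z powr s * \<phi> z\<close>, applied to the difference
  quotients of order \<open>s\<close>, needs only the former and yields the same bound as
  Minkowski's integral inequality.
\<close>

lemma convolution_error_le:
  fixes f \<phi> :: "'a::euclidean_space \<Rightarrow> real" and p s k T :: real
  assumes [measurable]: "f \<in> borel_measurable borel" "\<phi> \<in> borel_measurable borel"
    and p: "1 < p" and k: "0 < k" and T: "0 \<le> T"
    and \<phi>: "\<And>z. 0 \<le> \<phi> z" "(\<integral>\<^sup>+z. ennreal (\<phi> z) \<partial>lborel) = 1"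
    and moment: "(\<integral>\<^sup>+z. ennreal (norm z powr s * \<phi> z) \<partial>lborel) \<le> ennreal k"
    and shift: "\<And>z. translation_energy p f z \<le> ennreal (T * norm z powr (s * p))"
    and conv: "AE x in lborel. integrable lborel (\<lambda>z. \<phi> z * f (x - z))"
  shows "(\<integral>\<^sup>+x. ennreal (\<bar>(\<integral>z. \<phi> z * f (x - z) \<partial>lborel) - f x\<bar> powr p) \<partial>lborel) \<le> ennreal (k powr p * T)"
proof -
  define w where "w = (\<lambda>z. norm z powr s * \<phi> z)"
  have [measurable]: "w \<in> borel_measurable borel" unfolding w_def by measurable
  have w0: "0 \<le> w z" for z using \<phi> by (simp add: w_def)
  define N where "N = density lborel (\<lambda>z. ennreal (w z))"
  have mass: "emeasure N (space N) \<le> ennreal k"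
    using moment by (simp add: N_def emeasure_density w_def)
  have N: "finite_measure N"
    by standard (use mass in \<open>auto simp: top_unique\<close>)
  have mass': "measure N (space N) \<le> k"
    using mass k by (simp add: measure_def enn2real_leI)
  define Q where "Q = (\<lambda>x z. (f (x - z) - f x) / norm z powr s)"
  have [measurable]: "(\<lambda>(x, z). Q x z) \<in> borel_measurable (borel \<Otimes>\<^sub>M borel)" unfolding Q_def by measurable
  have \<phi>int: "integrable lborel \<phi>" "(\<integral>z. \<phi> z \<partial>lborel) = 1"
    using \<phi> by (auto simp: integrable_iff_bounded integral_eq_nn_integral)
  have "AE x in lborel. ennreal (\<bar>(\<integral>z. \<phi> z * f (x - z) \<partial>lborel) - f x\<bar> powr p)
      \<le> ennreal (k powr (p - 1)) * (\<integral>\<^sup>+z. ennreal (w z * \<bar>Q x z\<bar> powr p) \<partial>lborel)"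
    using conv
  proof (rule AE_mp, intro AE_I2 impI)
    fix x assume int: "integrable lborel (\<lambda>z. \<phi> z * f (x - z))"
    have "(\<integral>z. Q x z \<partial>N) = (\<integral>z. w z * Q x z \<partial>lborel)"
      unfolding N_def using w0 by (subst integral_density) auto
    also have "\<dots> = (\<integral>z. \<phi> z * f (x - z) - \<phi> z * f x \<partial>lborel)"
    proof (rule Bochner_Integration.integral_cong)
      fix z
      show "w z * Q x z = \<phi> z * f (x - z) - \<phi> z * f x"
        by (cases "z = 0") (simp_all add: w_def Q_def right_diff_distrib[symmetric])
    qed simp
    also have "\<dots> = (\<integral>z. \<phi> z * f (x - z) \<partial>lborel) - f x"
      using int \<phi>int by simp
    finally show "ennreal (\<bar>(\<integral>z. \<phi> z * f (x - z) \<partial>lborel) - f x\<bar> powr p)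
      \<le> ennreal (k powr (p - 1)) * (\<integral>\<^sup>+z. ennreal (w z * \<bar>Q x z\<bar> powr p) \<partial>lborel)"
      using abs_integral_powr_le[OF N _ p k mass', of "Q x"] w0
      by (simp add: N_def nn_integral_density ennreal_mult)
  qed
  then have "(\<integral>\<^sup>+x. ennreal (\<bar>(\<integral>z. \<phi> z * f (x - z) \<partial>lborel) - f x\<bar> powr p) \<partial>lborel)
    \<le> (\<integral>\<^sup>+x. ennreal (k powr (p - 1)) * (\<integral>\<^sup>+z. ennreal (w z * \<bar>Q x z\<bar> powr p) \<partial>lborel) \<partial>lborel)"
    by (rule nn_integral_mono_AE)
  also have "\<dots> = ennreal (k powr (p - 1)) * (\<integral>\<^sup>+x. \<integral>\<^sup>+z. ennreal (w z * \<bar>Q x z\<bar> powr p) \<partial>lborel \<partial>lborel)"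
    by (rule nn_integral_cmult) measurable
  also have "(\<integral>\<^sup>+x. \<integral>\<^sup>+z. ennreal (w z * \<bar>Q x z\<bar> powr p) \<partial>lborel \<partial>lborel)
     = (\<integral>\<^sup>+z. \<integral>\<^sup>+x. ennreal (w z * \<bar>Q x z\<bar> powr p) \<partial>lborel \<partial>lborel)"
    by (rule lborel_pair.Fubini'[symmetric]) measurable
  also have "\<dots> \<le> (\<integral>\<^sup>+z. ennreal (w z) * ennreal T \<partial>lborel)"
  proof (rule nn_integral_mono)
    fix z :: 'a
    have "(\<integral>\<^sup>+x. ennreal (w z * \<bar>Q x z\<bar> powr p) \<partial>lborel)
        = (\<integral>\<^sup>+x. ennreal (w z / norm z powr (s * p)) * ennreal (\<bar>f (x - z) - f x\<bar> powr p) \<partial>lborel)"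
      using w0 by (intro nn_integral_cong) (simp add: Q_def abs_divide powr_divide powr_powr flip: ennreal_mult)
    also have "\<dots> = ennreal (w z / norm z powr (s * p)) * translation_energy p f z"
      unfolding translation_energy_def by (rule nn_integral_cmult) measurable
    also have "\<dots> \<le> ennreal (w z / norm z powr (s * p)) * ennreal (T * norm z powr (s * p))"
      by (intro mult_left_mono shift) auto
    also have "\<dots> = ennreal (w z / norm z powr (s * p) * (T * norm z powr (s * p)))"
      using w0 T by (intro ennreal_mult[symmetric]) auto
    also have "w z / norm z powr (s * p) * (T * norm z powr (s * p)) \<le> w z * T"
      using w0[of z] T by (cases "norm z powr (s * p) = 0") auto
    finally show "(\<integral>\<^sup>+x. ennreal (w z * \<bar>Q x z\<bar> powr p) \<partial>lborel) \<le> ennreal (w z) * ennreal T"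
      using w0 T by (simp add: ennreal_mult ennreal_leI)
  qed
  also have "\<dots> \<le> ennreal k * ennreal T"
    using moment by (simp add: nn_integral_multc w_def mult_right_mono)
  also have "ennreal (k powr (p - 1)) * (ennreal k * ennreal T) = ennreal (k powr p * T)"
    using k T by (simp add: powr_diff flip: ennreal_mult)
  finally show ?thesis by (simp add: mult_left_mono)
qed

lemma dilate_nonneg: "0 \<le> \<nu> \<Longrightarrow> (\<And>x. 0 \<le> \<phi> x) \<Longrightarrow> 0 \<le> dilate \<nu> \<phi> x"
  by (simp add: dilate_def)

lemma borel_measurable_dilate [measurable]:
  assumes [measurable]: "\<phi> \<in> borel_measurable borel"
  shows "dilate \<nu> \<phi> \<in> borel_measurable borel"
  unfolding dilate_def by measurable

text \<open>
  The cases used are the mass (\<open>s = 0\<close>, \<open>p = 1\<close>), the \<open>p\<close>-th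
  power of the \<open>L\<^sub>p\<close> norm (\<open>s = 0\<close>) and the moment of order
  \<open>s\<close> (\<open>p = 1\<close>).
\<close>

lemma nn_integral_dilate_powr:
  fixes \<phi> :: "real ^ 'd \<Rightarrow> real"
  assumes [measurable]: "\<phi> \<in> borel_measurable borel" and \<nu>: "0 < \<nu>" and \<phi>: "\<And>x. 0 \<le> \<phi> x"
  shows "(\<integral>\<^sup>+x. ennreal (norm x powr s * dilate \<nu> \<phi> x powr p) \<partial>lborel)
    = ennreal (\<nu> powr (real CARD('d) * (p - 1) - s)) * (\<integral>\<^sup>+x. ennreal (norm x powr s * \<phi> x powr p) \<partial>lborel)"
proof -
  have *: "ennreal (norm x powr s * dilate \<nu> \<phi> x powr p) =
     ennreal (\<nu> powr (real CARD('d) * p - s)) * ennreal (norm (\<nu> *\<^sub>R x) powr s * \<phi> (\<nu> *\<^sub>R x) powr p)" for x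
  proof -
    have "norm x powr s * dilate \<nu> \<phi> x powr p
       = \<nu> powr (real CARD('d) * p - s) * (norm (\<nu> *\<^sub>R x) powr s * \<phi> (\<nu> *\<^sub>R x) powr p)"
      using \<nu> \<phi> by (simp add: dilate_def powr_mult powr_diff powr_powr flip: powr_realpow)
    then show ?thesis using \<phi> by (simp flip: ennreal_mult)
  qed
  have "(\<integral>\<^sup>+x. ennreal (norm x powr s * dilate \<nu> \<phi> x powr p) \<partial>lborel)
     = ennreal (\<nu> powr (real CARD('d) * p - s)) * (\<integral>\<^sup>+x. ennreal (norm (\<nu> *\<^sub>R x) powr s * \<phi> (\<nu> *\<^sub>R x) powr p) \<partial>lborel)"
    unfolding * by (rule nn_integral_cmult) measurable
  also have "ennreal (\<nu> powr (real CARD('d) * p - s)) =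
      ennreal (\<nu> powr (real CARD('d) * (p - 1) - s)) * ennreal (\<nu> ^ CARD('d))"
    using \<nu> by (simp add: powr_diff right_diff_distrib powr_realpow flip: ennreal_mult)
  also have "\<dots> * (\<integral>\<^sup>+x. ennreal (norm (\<nu> *\<^sub>R x) powr s * \<phi> (\<nu> *\<^sub>R x) powr p) \<partial>lborel)
      = ennreal (\<nu> powr (real CARD('d) * (p - 1) - s)) * (\<integral>\<^sup>+x. ennreal (norm x powr s * \<phi> x powr p) \<partial>lborel)"
    using nn_integral_lborel_affine[of "\<lambda>x. ennreal (norm x powr s * \<phi> x powr p)" \<nu> 0] \<nu>
    by (simp add: mult.assoc)
  finally show ?thesis .
qed

text \<open>
  The integrands differ at the origin, where \<open>0 powr 0 = 0\<close>.
\<close>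

lemma nn_integral_powr_zero:
  fixes h :: "real ^ 'd \<Rightarrow> real"
  shows "(\<integral>\<^sup>+x. ennreal (norm x powr 0 * h x) \<partial>lborel) = (\<integral>\<^sup>+x. ennreal (h x) \<partial>lborel)"
proof (rule nn_integral_cong_AE)
  show "AE x in lborel. ennreal (norm (x :: real ^ 'd) powr 0 * h x) = ennreal (h x)"
    using AE_lborel_singleton[of 0] by eventually_elim simp
qed

text \<open>
  The convolution of \<open>f\<close> with the dilate of \<open>\<phi>\<close> is the mean of the
  translates under the probability measure with density \<open>f\<close>. The first term of the
  bound is the cost of replacing this mean by an average of \<open>m\<close> translates, the second
  one the smoothing error.
\<close>

lemma mixture_approximation_fixed_scale:
  fixes \<phi> f :: "real ^ 'd \<Rightarrow> real" and p s P k T C :: real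
  assumes [measurable]: "f \<in> borel_measurable borel" "\<phi> \<in> borel_measurable borel"
    and p: "1 < p" and k: "0 < k" and T: "0 \<le> T" and P: "0 \<le> P"
    and \<phi>: "\<And>z. 0 \<le> \<phi> z" "(\<integral>\<^sup>+z. ennreal (\<phi> z) \<partial>lborel) = 1"
    and f: "\<And>z. 0 \<le> f z" "(\<integral>\<^sup>+z. ennreal (f z) \<partial>lborel) = 1"
    and \<phi>p: "(\<integral>\<^sup>+z. ennreal (\<phi> z powr p) \<partial>lborel) \<le> ennreal P"
    and moment: "(\<integral>\<^sup>+z. ennreal (norm z powr s * \<phi> z) \<partial>lborel) \<le> ennreal k"
    and shift: "\<And>z. translation_energy p f z \<le> ennreal (T * norm z powr (s * p))"
    and bound: "second_order_powr_bound p C"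
    and \<nu>: "0 < \<nu>" and m: "0 < m"
  shows "\<exists>\<mu>. (\<integral>\<^sup>+x. ennreal (\<bar>(\<Sum>j<m. dilate \<nu> \<phi> (x - \<mu> j)) / real m - f x\<bar> powr p) \<partial>lborel)
     \<le> ennreal (2 powr (p - 1) * (2 * C * 2 powr p * P * \<nu> powr (real CARD('d) * (p - 1)) * real m powr (max 1 (p / 2) - p)
          + k powr p * T * \<nu> powr - (s * p)))"
proof -
  have C: "0 \<le> C" using bound by (simp add: second_order_powr_bound_def)
  define \<psi> where "\<psi> = dilate \<nu> \<phi>"
  have [measurable]: "\<psi> \<in> borel_measurable borel" unfolding \<psi>_def by measurable
  have \<psi>0: "0 \<le> \<psi> x" for x using \<nu> \<phi> by (simp add: \<psi>_def dilate_nonneg)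
  have p1: "\<psi> x powr 1 = \<psi> x" "\<phi> x powr 1 = \<phi> x" for x using \<psi>0 \<phi> by auto
  have \<psi>1: "(\<integral>\<^sup>+z. ennreal (\<psi> z) \<partial>lborel) = 1"
    using nn_integral_dilate_powr[of \<phi> \<nu> 0 1] \<nu> \<phi> p1 powr_zero_eq_one[of \<nu>] unfolding \<psi>_def
    by (simp add: nn_integral_powr_zero del: powr_zero_eq_one powr_one)
  have \<psi>p: "(\<integral>\<^sup>+z. ennreal (\<psi> z powr p) \<partial>lborel) \<le> ennreal (P * \<nu> powr (real CARD('d) * (p - 1)))"
  proof -
    have "(\<integral>\<^sup>+z. ennreal (\<psi> z powr p) \<partial>lborel)
        = ennreal (\<nu> powr (real CARD('d) * (p - 1))) * (\<integral>\<^sup>+z. ennreal (\<phi> z powr p) \<partial>lborel)"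
      using nn_integral_dilate_powr[of \<phi> \<nu> 0 p, unfolded nn_integral_powr_zero] \<nu> \<phi>
      unfolding \<psi>_def by simp
    also have "\<dots> \<le> ennreal (\<nu> powr (real CARD('d) * (p - 1))) * ennreal P"
      by (intro mult_left_mono \<phi>p) auto
    finally show ?thesis using P by (simp add: ennreal_mult mult.commute)
  qed
  have \<psi>m: "(\<integral>\<^sup>+z. ennreal (norm z powr s * \<psi> z) \<partial>lborel) \<le> ennreal (k * \<nu> powr - s)"
  proof -
    have "(\<integral>\<^sup>+z. ennreal (norm z powr s * \<psi> z) \<partial>lborel)
        = ennreal (\<nu> powr - s) * (\<integral>\<^sup>+z. ennreal (norm z powr s * \<phi> z) \<partial>lborel)"
      using nn_integral_dilate_powr[of \<phi> \<nu> s 1] \<nu> \<phi> unfolding p1 \<psi>_def[symmetric] by simp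
    also have "\<dots> \<le> ennreal (\<nu> powr - s) * ennreal k"
      by (intro mult_left_mono moment) auto
    finally show ?thesis using k by (simp add: ennreal_mult mult.commute)
  qed
  define M where "M = density lborel (\<lambda>x. ennreal (f x))"
  define g where "g = (\<lambda>x. \<integral>\<mu>. \<psi> (x - \<mu>) \<partial>M)"
  have sM[measurable_cong]: "sets M = sets borel" by (simp add: M_def)
  have M1: "emeasure M (space M) = 1" using f by (simp add: M_def emeasure_density)
  have g: "g x = (\<integral>z. \<psi> z * f (x - z) \<partial>lborel)" for x
  proof -
    have "g x = (\<integral>\<mu>. f \<mu> * \<psi> (x - \<mu>) \<partial>lborel)"
      unfolding g_def M_def using f by (subst integral_density) auto
    also have "\<dots> = (\<integral>z. \<psi> z * f (x - z) \<partial>lborel)"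
      using lborel_integral_reflect[of "\<lambda>z. \<psi> z * f (x - z)" x] by (simp add: mult.commute)
    finally show ?thesis .
  qed
  have energy: "(\<integral>\<^sup>+x. \<integral>\<^sup>+\<mu>. ennreal (\<bar>\<psi> (x - \<mu>)\<bar> powr p) \<partial>M \<partial>lborel) \<le> ennreal (P * \<nu> powr (real CARD('d) * (p - 1)))"
  proof -
    have "(\<integral>\<^sup>+x. \<integral>\<^sup>+\<mu>. ennreal (\<bar>\<psi> (x - \<mu>)\<bar> powr p) \<partial>M \<partial>lborel)
      = (\<integral>\<^sup>+x. \<integral>\<^sup>+\<mu>. ennreal (f \<mu>) * ennreal (\<psi> (x - \<mu>) powr p) \<partial>lborel \<partial>lborel)"
      unfolding M_def using \<psi>0 by (simp add: nn_integral_density)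
    also have "\<dots> = (\<integral>\<^sup>+\<mu>. \<integral>\<^sup>+x. ennreal (f \<mu>) * ennreal (\<psi> (x - \<mu>) powr p) \<partial>lborel \<partial>lborel)"
      by (rule lborel_pair.Fubini'[symmetric]) measurable
    also have "\<dots> = (\<integral>\<^sup>+\<mu>. ennreal (f \<mu>) * (\<integral>\<^sup>+x. ennreal (\<psi> x powr p) \<partial>lborel) \<partial>lborel)"
      using nn_integral_lborel_minus[of "\<lambda>x. ennreal (\<psi> x powr p)"] by (simp add: nn_integral_cmult)
    also have "\<dots> = (\<integral>\<^sup>+x. ennreal (\<psi> x powr p) \<partial>lborel)"
      using f by (simp add: nn_integral_multc)
    finally show ?thesis using \<psi>p by simp
  qed
  have conv: "AE x in lborel. integrable lborel (\<lambda>z. \<psi> z * f (x - z))"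
  proof -
    have "(\<integral>\<^sup>+x. \<integral>\<^sup>+z. ennreal (\<psi> z * f (x - z)) \<partial>lborel \<partial>lborel)
       = (\<integral>\<^sup>+z. \<integral>\<^sup>+x. ennreal (\<psi> z * f (x - z)) \<partial>lborel \<partial>lborel)"
      by (rule lborel_pair.Fubini'[symmetric]) measurable
    also have "\<dots> = (\<integral>\<^sup>+z. ennreal (\<psi> z) * (\<integral>\<^sup>+x. ennreal (f (x - z)) \<partial>lborel) \<partial>lborel)"
      using f \<psi>0 by (simp add: ennreal_mult nn_integral_cmult)
    also have "\<dots> = 1"
      using nn_integral_lborel_minus[of "\<lambda>x. ennreal (f x)"] f \<psi>1 by simp
    finally have "AE x in lborel. (\<integral>\<^sup>+z. ennreal (\<psi> z * f (x - z)) \<partial>lborel) \<noteq> \<infinity>"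
      by (intro nn_integral_PInf_AE) auto
    then show ?thesis
      by eventually_elim (use f \<psi>0 in \<open>auto simp: integrable_iff_bounded abs_mult top.not_eq_extremum\<close>)
  qed
  obtain \<mu> where \<mu>: "(\<integral>\<^sup>+x. ennreal (\<bar>(\<Sum>j<m. \<psi> (x - \<mu> j)) / real m - g x\<bar> powr p) \<partial>lborel)
          \<le> ennreal (2 * C * 2 powr p * (P * \<nu> powr (real CARD('d) * (p - 1))) * real m powr (max 1 (p / 2) - p))"
    using Lp_empirical_approximation[of p C M lborel "\<lambda>\<mu> x. \<psi> (x - \<mu>)", OF p bound M1 _ _ _ energy m]
      P lborel.sigma_finite_measure_axioms
    unfolding g_def by auto
  have [measurable]: "g \<in> borel_measurable borel"
    unfolding g[abs_def] by measurable
  have smooth: "(\<integral>\<^sup>+x. ennreal (\<bar>g x - f x\<bar> powr p) \<partial>lborel) \<le> ennreal ((k * \<nu> powr - s) powr p * T)"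
    unfolding g using \<psi>0 \<psi>1 \<psi>m k \<nu> p T shift conv by (intro convolution_error_le[where s=s]) auto
  have "(\<integral>\<^sup>+x. ennreal (\<bar>(\<Sum>j<m. \<psi> (x - \<mu> j)) / real m - f x\<bar> powr p) \<partial>lborel)
    \<le> (\<integral>\<^sup>+x. ennreal (2 powr (p - 1)) * (ennreal (\<bar>(\<Sum>j<m. \<psi> (x - \<mu> j)) / real m - g x\<bar> powr p)
        + ennreal (\<bar>g x - f x\<bar> powr p)) \<partial>lborel)"
  proof (rule nn_integral_mono)
    fix x
    show "ennreal (\<bar>(\<Sum>j<m. \<psi> (x - \<mu> j)) / real m - f x\<bar> powr p)
      \<le> ennreal (2 powr (p - 1)) * (ennreal (\<bar>(\<Sum>j<m. \<psi> (x - \<mu> j)) / real m - g x\<bar> powr p)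
        + ennreal (\<bar>g x - f x\<bar> powr p))"
      using abs_powr_add_le[of p "(\<Sum>j<m. \<psi> (x - \<mu> j)) / real m - g x" "g x - f x"] p
      by (simp flip: ennreal_plus ennreal_mult)
  qed
  also have "\<dots> = ennreal (2 powr (p - 1)) * ((\<integral>\<^sup>+x. ennreal (\<bar>(\<Sum>j<m. \<psi> (x - \<mu> j)) / real m - g x\<bar> powr p) \<partial>lborel)
        + (\<integral>\<^sup>+x. ennreal (\<bar>g x - f x\<bar> powr p) \<partial>lborel))"
    by (simp add: nn_integral_cmult nn_integral_add)
  also have "\<dots> \<le> ennreal (2 powr (p - 1)) * (ennreal (2 * C * 2 powr p * (P * \<nu> powr (real CARD('d) * (p - 1))) * real m powr (max 1 (p / 2) - p))
      + ennreal ((k * \<nu> powr - s) powr p * T))"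
    by (intro mult_left_mono add_mono \<mu> smooth) auto
  also have "\<dots> = ennreal (2 powr (p - 1) * (2 * C * 2 powr p * (P * \<nu> powr (real CARD('d) * (p - 1))) * real m powr (max 1 (p / 2) - p)
      + (k * \<nu> powr - s) powr p * T))"
    using C P T by (simp flip: ennreal_plus ennreal_mult)
  also have "(k * \<nu> powr - s) powr p * T = k powr p * T * \<nu> powr - (s * p)"
    using k \<nu> by (simp add: powr_mult powr_powr)
  finally show ?thesis by (intro exI[of _ \<mu>]) (simp add: \<psi>_def mult.assoc)
qed

section \<open>Smooth bump functions and test functions\<close>

text \<open>
  The functions \<open>P(1/t) exp(-1/t)\<close>, extended by zero to the left of the origin. They
  form a family closed under differentiation, so that one induction yields derivatives of all
  orders.
\<close>

definition flat_exp :: "real poly \<Rightarrow> real \<Rightarrow> real" where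
  "flat_exp P t = (if t \<le> 0 then 0 else poly P (1 / t) * exp (- (1 / t)))"

lemma tendsto_poly_times_exp_minus: "((\<lambda>u::real. poly P u * exp (- u)) \<longlongrightarrow> 0) at_top"
proof -
  have "((\<lambda>u::real. \<Sum>i\<le>degree P. coeff P i * (u ^ i / exp u)) \<longlongrightarrow> (\<Sum>i\<le>degree P. coeff P i * 0)) at_top"
    by (intro tendsto_sum tendsto_mult tendsto_const tendsto_power_div_exp_0)
  then show ?thesis
    by (simp add: poly_altdef sum_distrib_right exp_minus divide_inverse mult.assoc)
qed

lemma tendsto_flat_exp_0: "(flat_exp P \<longlongrightarrow> 0) (at_right 0)"
proof -
  have "((\<lambda>t. poly P (inverse t) * exp (- inverse t)) \<longlongrightarrow> 0) (at_right (0::real))"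
    by (rule filterlim_compose[OF tendsto_poly_times_exp_minus filterlim_inverse_at_top_right])
  moreover have "eventually (\<lambda>t. poly P (inverse t) * exp (- inverse t) = flat_exp P t) (at_right 0)"
    using eventually_at_right_less[of "0::real"]
    by eventually_elim (simp add: flat_exp_def inverse_eq_divide)
  ultimately show ?thesis by (rule Lim_transform_eventually)
qed

text \<open>
  The substitution \<open>u = 1/t\<close> contributes the factor \<open>- u\<^sup>2\<close>. At the
  origin the difference quotient is again a function of this kind, with \<open>P\<close> multiplied
  by \<open>u\<close>, and it tends to zero.
\<close>

lemma DERIV_flat_exp: "(flat_exp P has_real_derivative flat_exp ([:0, 0, 1:] * (P - pderiv P)) t) (at t)"
proof -
  consider "t < 0" | "t > 0" | "t = 0" by linarith
  then show ?thesis
  proof cases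
    case 1
    have "((\<lambda>_. 0) has_real_derivative 0) (at t)" by simp
    then have "(flat_exp P has_real_derivative 0) (at t)"
      by (rule has_field_derivative_transform_within_open[where S="{..<0}"])
        (use 1 in \<open>auto simp: flat_exp_def\<close>)
    then show ?thesis using 1 by (simp add: flat_exp_def)
  next
    case 2
    have "((\<lambda>t. poly P (1 / t) * exp (- (1 / t))) has_real_derivative
        poly ([:0, 0, 1:] * (P - pderiv P)) (1 / t) * exp (- (1 / t))) (at t)"
      using 2 by (auto intro!: derivative_eq_intros DERIV_chain2[OF poly_DERIV]
          simp: field_simps power2_eq_square)
    then have "(flat_exp P has_real_derivative poly ([:0, 0, 1:] * (P - pderiv P)) (1 / t) * exp (- (1 / t))) (at t)"
      by (rule has_field_derivative_transform_within_open[where S="{0<..}"])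
        (use 2 in \<open>auto simp: flat_exp_def\<close>)
    then show ?thesis using 2 by (simp add: flat_exp_def)
  next
    case 3
    have "((\<lambda>h. (flat_exp P (0 + h) - flat_exp P 0) / h) \<longlongrightarrow> 0) (at 0)"
    proof (rule filterlim_split_at)
      show "((\<lambda>h. (flat_exp P (0 + h) - flat_exp P 0) / h) \<longlongrightarrow> 0) (at_left 0)"
        by (rule tendsto_eventually)
          (auto simp: flat_exp_def eventually_at_filter intro!: always_eventually)
      have "eventually (\<lambda>h. flat_exp ([:0, 1:] * P) h = (flat_exp P (0 + h) - flat_exp P 0) / h) (at_right 0)"
        using eventually_at_right_less[of "0::real"]
        by eventually_elim (simp add: flat_exp_def)
      then show "((\<lambda>h. (flat_exp P (0 + h) - flat_exp P 0) / h) \<longlongrightarrow> 0) (at_right 0)"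
        by (rule Lim_transform_eventually[OF tendsto_flat_exp_0])
    qed
    then show ?thesis using 3 by (simp add: DERIV_def flat_exp_def)
  qed
qed

text \<open>
  A class of differentiable functions that contains the bumps below and is closed under partial
  derivatives; induction on the order then shows that its members are smooth.
\<close>

inductive_set flat_exp_algebra :: "(real ^ 'd \<Rightarrow> real) set" where
  const: "(\<lambda>_. c) \<in> flat_exp_algebra"
| flat: "(\<lambda>x. flat_exp P (a * x $ i + b)) \<in> flat_exp_algebra"
| add: "f \<in> flat_exp_algebra \<Longrightarrow> g \<in> flat_exp_algebra \<Longrightarrow> (\<lambda>x. f x + g x) \<in> flat_exp_algebra"
| mult: "f \<in> flat_exp_algebra \<Longrightarrow> g \<in> flat_exp_algebra \<Longrightarrow> (\<lambda>x. f x * g x) \<in> flat_exp_algebra"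

lemma flat_exp_algebra_derivative:
  fixes f :: "real ^ 'd \<Rightarrow> real"
  assumes "f \<in> flat_exp_algebra"
  shows "\<exists>G. (\<forall>k. G k \<in> flat_exp_algebra) \<and>
    (\<forall>x. (f has_derivative (\<lambda>v. \<Sum>k\<in>UNIV. v $ k * G k x)) (at x))"
  using assms
proof induction
  case (const c)
  then show ?case
    by (intro exI[of _ "\<lambda>_ _. 0"]) (auto intro: flat_exp_algebra.const)
next
  case (flat P a i b)
  define Q where "Q = [:0, 0, 1:] * (P - pderiv P)"
  define G where "G = (\<lambda>k (x :: real ^ 'd). (if k = i then a else 0) * flat_exp Q (a * x $ i + b))"
  have "G k \<in> flat_exp_algebra" for k
    unfolding G_def by (intro flat_exp_algebra.mult flat_exp_algebra.const flat_exp_algebra.flat)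
  moreover have "((\<lambda>x. flat_exp P (a * x $ i + b)) has_derivative (\<lambda>v. \<Sum>k\<in>UNIV. v $ k * G k x)) (at x)" for x
  proof -
    have "((\<lambda>x :: real ^ 'd. a * x $ i + b) has_derivative (\<lambda>v. a * v $ i)) (at x)"
      by (auto intro!: derivative_eq_intros bounded_linear_imp_has_derivative bounded_linear_vec_nth)
    moreover have "(flat_exp P has_derivative (\<lambda>h. flat_exp Q (a * x $ i + b) * h)) (at (a * x $ i + b))"
      using DERIV_flat_exp[of P "a * x $ i + b"] by (simp add: has_field_derivative_def Q_def)
    ultimately have "((\<lambda>x. flat_exp P (a * x $ i + b)) has_derivative
        (\<lambda>v. flat_exp Q (a * x $ i + b) * (a * v $ i))) (at x)"
      by (rule has_derivative_compose)
    also have "(\<lambda>v. flat_exp Q (a * x $ i + b) * (a * v $ i)) = (\<lambda>v. \<Sum>k\<in>UNIV. v $ k * G k x)"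
      by (simp add: G_def if_distrib if_distribR cong: if_cong) (simp add: mult_ac)
    finally show ?thesis .
  qed
  ultimately show ?case by (intro exI[of _ G]) auto
next
  case (add f g)
  then obtain F G where F: "\<And>k. F k \<in> flat_exp_algebra" "\<And>x. (f has_derivative (\<lambda>v. \<Sum>k\<in>UNIV. v $ k * F k x)) (at x)"
    and G: "\<And>k. G k \<in> flat_exp_algebra" "\<And>x. (g has_derivative (\<lambda>v. \<Sum>k\<in>UNIV. v $ k * G k x)) (at x)"
    by blast
  have "((\<lambda>x. f x + g x) has_derivative (\<lambda>v. \<Sum>k\<in>UNIV. v $ k * (F k x + G k x))) (at x)" for x
    using has_derivative_add[OF F(2)[of x] G(2)[of x]] by (simp add: distrib_left sum.distrib)
  moreover have "(\<lambda>x. F k x + G k x) \<in> flat_exp_algebra" for k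
    using flat_exp_algebra.add[OF F(1) G(1)] .
  ultimately show ?case by (intro exI[of _ "\<lambda>k x. F k x + G k x"]) simp
next
  case (mult f g)
  then obtain F G where F: "\<And>k. F k \<in> flat_exp_algebra" "\<And>x. (f has_derivative (\<lambda>v. \<Sum>k\<in>UNIV. v $ k * F k x)) (at x)"
    and G: "\<And>k. G k \<in> flat_exp_algebra" "\<And>x. (g has_derivative (\<lambda>v. \<Sum>k\<in>UNIV. v $ k * G k x)) (at x)"
    by blast
  have "((\<lambda>x. f x * g x) has_derivative (\<lambda>v. \<Sum>k\<in>UNIV. v $ k * (f x * G k x + F k x * g x))) (at x)" for x
    using has_derivative_mult[OF F(2)[of x] G(2)[of x]]
    by (simp add: distrib_left sum.distrib sum_distrib_left sum_distrib_right mult_ac)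
  moreover have "(\<lambda>x. f x * G k x + F k x * g x) \<in> flat_exp_algebra" for k
    using flat_exp_algebra.add[OF flat_exp_algebra.mult[OF mult.hyps(1) G(1)] flat_exp_algebra.mult[OF F(1) mult.hyps(2)]] .
  ultimately show ?case by (intro exI[of _ "\<lambda>k x. f x * G k x + F k x * g x"]) simp
qed

lemma partial_eqI:
  assumes "(f has_derivative (\<lambda>v. \<Sum>k\<in>UNIV. v $ k * G k)) (at x)"
  shows "partial k f x = G k"
proof -
  have "frechet_derivative f (at x) = (\<lambda>v. \<Sum>k\<in>UNIV. v $ k * G k)"
    by (rule frechet_derivative_at[OF assms, symmetric])
  then show ?thesis by (simp add: partial_def axis_def if_distrib if_distribR cong: if_cong)
qed

lemma flat_exp_algebra_smooth:
  "f \<in> flat_exp_algebra \<Longrightarrow> times_continuously_differentiable n f"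
proof (induction n arbitrary: f)
  case 0
  then obtain G where "\<And>x. (f has_derivative (\<lambda>v. \<Sum>k\<in>UNIV. v $ k * G k x)) (at x)"
    using flat_exp_algebra_derivative by blast
  then have "continuous (at x) f" for x
    using has_derivative_continuous by blast
  then show ?case by (simp add: continuous_at_imp_continuous_on)
next
  case (Suc n)
  then obtain G where G: "\<And>k. G k \<in> flat_exp_algebra"
    "\<And>x. (f has_derivative (\<lambda>v. \<Sum>k\<in>UNIV. v $ k * G k x)) (at x)"
    using flat_exp_algebra_derivative by blast
  have "partial k f = G k" for k
    using partial_eqI[OF G(2)] by blast
  then show ?case using G Suc.IH by (auto simp: differentiable_def)
qed

lemma flat_exp_algebra_prod:
  "finite A \<Longrightarrow> (\<And>i. i \<in> A \<Longrightarrow> f i \<in> flat_exp_algebra) \<Longrightarrow> (\<lambda>x. \<Prod>i\<in>A. f i x) \<in> flat_exp_algebra"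
proof (induction A rule: finite_induct)
  case empty
  then show ?case by (simp add: flat_exp_algebra.const)
next
  case (insert i A)
  then show ?case by (simp add: flat_exp_algebra.mult)
qed

text \<open>
  Rescaling the argument of \<open>exp(-1/t)\<close> by \<open>n + 1\<close> amounts to taking the
  root of order \<open>n + 1\<close>. Hence these functions converge to the indicator of the open
  box while their supports stay in its closure.
\<close>

definition box_bump :: "nat \<Rightarrow> real ^ 'd \<Rightarrow> real ^ 'd \<Rightarrow> real ^ 'd \<Rightarrow> real" where
  "box_bump n a b x = (\<Prod>i\<in>UNIV. flat_exp 1 (real (Suc n) * (x $ i - a $ i)) * flat_exp 1 (real (Suc n) * (b $ i - x $ i)))"

lemma flat_exp_1_bounds: "0 \<le> flat_exp 1 t" "flat_exp 1 t \<le> 1"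
  by (auto simp: flat_exp_def)

lemma box_bump_bounds: "0 \<le> box_bump n a b x" "box_bump n a b x \<le> 1"
  unfolding box_bump_def
  by (auto intro!: prod_nonneg prod_le_1 mult_nonneg_nonneg mult_le_one flat_exp_1_bounds)

lemma box_bump_outside: "x \<notin> box a b \<Longrightarrow> box_bump n a b x = 0"
  unfolding box_bump_def by (auto simp: mem_box_cart flat_exp_def zero_less_mult_iff not_less mult_le_0_iff)

lemma box_bump_in_test_functions: "box_bump n a b \<in> test_functions"
proof -
  have e: "real (Suc n) * (x $ i - a $ i) = real (Suc n) * x $ i + (- (real (Suc n) * a $ i))"
    "real (Suc n) * (b $ i - x $ i) = - real (Suc n) * x $ i + real (Suc n) * b $ i" for x i
    by (simp_all add: algebra_simps)
  have "box_bump n a b \<in> flat_exp_algebra"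
    unfolding box_bump_def[abs_def] e
    by (intro flat_exp_algebra_prod flat_exp_algebra.mult flat_exp_algebra.flat) auto
  moreover have "compact (closure {x. box_bump n a b x \<noteq> 0})"
  proof -
    have "{x. box_bump n a b x \<noteq> 0} \<subseteq> box a b" using box_bump_outside by blast
    then show ?thesis using bounded_subset[OF bounded_box] compact_closure by blast
  qed
  ultimately show ?thesis by (simp add: test_functions_def flat_exp_algebra_smooth)
qed

lemma tendsto_flat_exp_scaled:
  assumes "0 < t"
  shows "(\<lambda>n. flat_exp 1 (real (Suc n) * t)) \<longlonglongrightarrow> 1"
proof -
  have "(\<lambda>n. exp (- (inverse (real (Suc n)) * (1 / t)))) \<longlonglongrightarrow> exp (- (0 * (1 / t)))"
    by (intro tendsto_intros LIMSEQ_inverse_real_of_nat)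
  then show ?thesis using assms by (simp add: flat_exp_def mult_le_0_iff not_less inverse_eq_divide del: of_nat_Suc)
qed

lemma tendsto_box_bump: "(\<lambda>n. box_bump n a b x) \<longlonglongrightarrow> indicator (box a b) x"
proof (cases "x \<in> box a b")
  case True
  have "(\<lambda>n. box_bump n a b x) \<longlonglongrightarrow> (\<Prod>i\<in>(UNIV :: 'a set). 1 * 1)"
    unfolding box_bump_def using True
    by (intro tendsto_prod tendsto_mult tendsto_flat_exp_scaled) (auto simp: mem_box_cart)
  then show ?thesis using True by simp
qed (simp add: box_bump_outside)

lemma test_function_continuous: "\<psi> \<in> test_functions \<Longrightarrow> continuous_on UNIV \<psi>"
  unfolding test_functions_def by (auto dest: spec[of _ 0])

lemma test_function_differentiable: "\<psi> \<in> test_functions \<Longrightarrow> \<psi> differentiable (at x)"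
  unfolding test_functions_def by (auto dest: spec[of _ 1])

lemma test_function_continuous_partial: "\<psi> \<in> test_functions \<Longrightarrow> continuous_on UNIV (partial k \<psi>)"
  unfolding test_functions_def by (auto dest: spec[of _ "Suc 0"])

lemma test_function_has_derivative:
  assumes "\<psi> \<in> test_functions"
  shows "(\<psi> has_derivative (\<lambda>v. \<Sum>k\<in>UNIV. v $ k * partial k \<psi> x)) (at x)"
proof -
  let ?D = "frechet_derivative \<psi> (at x)"
  have D: "(\<psi> has_derivative ?D) (at x)"
    using test_function_differentiable[OF assms] frechet_derivative_works by blast
  then interpret D: bounded_linear ?D by (rule has_derivative_bounded_linear)
  have "?D v = (\<Sum>k\<in>UNIV. v $ k * partial k \<psi> x)" for v
  proof -
    have "?D v = ?D (\<Sum>k\<in>UNIV. v $ k *s axis k 1)"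
      by (simp add: basis_expansion)
    also have "\<dots> = (\<Sum>k\<in>UNIV. v $ k * partial k \<psi> x)"
      by (simp add: D.sum D.scaleR partial_def scalar_mult_eq_scaleR)
    finally show ?thesis .
  qed
  then have "?D = (\<lambda>v. \<Sum>k\<in>UNIV. v $ k * partial k \<psi> x)" by (rule ext)
  with D show ?thesis by simp
qed

text \<open>
  The derivative vanishes outside a ball that contains the support, because the function is locally
  zero there.
\<close>

lemma test_function_support:
  assumes "\<psi> \<in> test_functions"
  shows "\<exists>R. \<forall>x. R < norm x \<longrightarrow> \<psi> x = 0 \<and> (\<forall>k. partial k \<psi> x = 0)"
proof -
  have "bounded {x. \<psi> x \<noteq> 0}"
    using assms bounded_subset[OF compact_imp_bounded closure_subset]
    by (simp add: test_functions_def)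
  then obtain R where R: "\<And>x. \<psi> x \<noteq> 0 \<Longrightarrow> norm x \<le> R" by (auto simp: bounded_iff)
  have "partial k \<psi> x = 0" if "R < norm x" for x k
  proof -
    have "open (- cball 0 R :: (real ^ 'a) set)" by (simp add: open_Compl)
    moreover have "\<psi> v = 0" if "v \<in> - cball 0 R" for v
      using R[of v] that by auto
    ultimately have "(\<psi> has_derivative (\<lambda>v. 0)) (at x)"
      using that by (intro has_derivative_transform_within_open[OF has_derivative_const[of 0]]) auto
    then show ?thesis using partial_eqI[of \<psi> "\<lambda>_. 0" x k] by simp
  qed
  with R show ?thesis by (intro exI[of _ R]) force
qed

lemma continuous_bounded_support_bounded:
  fixes h :: "'a::euclidean_space \<Rightarrow> real"
  assumes "continuous_on UNIV h" "\<And>x. R < norm x \<Longrightarrow> h x = 0"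
  shows "\<exists>B. \<forall>x. \<bar>h x\<bar> \<le> B"
proof -
  have "compact (h ` cball 0 R)"
    using assms by (intro compact_continuous_image) (auto intro: continuous_on_subset)
  then obtain B where "\<forall>y\<in>h ` cball 0 R. norm y \<le> B"
    using compact_imp_bounded bounded_iff by metis
  then have B: "\<bar>h x\<bar> \<le> B" if "x \<in> cball 0 R" for x
    using that by auto
  have "\<bar>h x\<bar> \<le> max 0 B" for x
    using assms(2)[of x] B[of x] by (cases "R < norm x") (auto simp: not_less le_max_iff_disj)
  then show ?thesis by blast
qed

lemma partial_translate:
  assumes "\<And>x. f differentiable (at x)"
  shows "partial k (\<lambda>x. f (x - a)) = (\<lambda>x. partial k f (x - a))"
proof
  fix x
  have "(f has_derivative frechet_derivative f (at (x - a))) (at (x - a))"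
    using assms frechet_derivative_works by blast
  moreover have "((\<lambda>x. x - a) has_derivative (\<lambda>v. v)) (at x)"
    by (auto intro!: derivative_eq_intros)
  ultimately have "((\<lambda>x. f (x - a)) has_derivative frechet_derivative f (at (x - a))) (at x)"
    using has_derivative_compose by blast
  then show "partial k (\<lambda>x. f (x - a)) x = partial k f (x - a)"
    unfolding partial_def using frechet_derivative_at by metis
qed

lemma times_continuously_differentiable_translate:
  "times_continuously_differentiable n f \<Longrightarrow> times_continuously_differentiable n (\<lambda>x. f (x - a))"
proof (induction n arbitrary: f)
  case 0
  then show ?case by (auto intro!: continuous_on_compose2[of UNIV f] continuous_intros)
next
  case (Suc n)
  then have "f differentiable (at x)" for x by simp
  moreover have "(\<lambda>x. f (x - a)) differentiable (at x)" for x
    using Suc.prems differentiable_chain_at[of "\<lambda>x. x - a" x f]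
    by (auto simp: o_def intro: derivative_intros)
  ultimately show ?case using Suc by (simp add: partial_translate)
qed

lemma test_function_translate:
  assumes "\<psi> \<in> test_functions"
  shows "(\<lambda>x. \<psi> (x - a)) \<in> test_functions"
proof -
  have "bounded {x. \<psi> x \<noteq> 0}"
    using assms bounded_subset[OF compact_imp_bounded closure_subset]
    by (simp add: test_functions_def)
  then have "bounded ((+) a ` {x. \<psi> x \<noteq> 0})" by (rule bounded_translation)
  moreover have "{x. \<psi> (x - a) \<noteq> 0} \<subseteq> (+) a ` {x. \<psi> x \<noteq> 0}"
    by (auto intro!: image_eqI[of _ _ "_ - a"])
  ultimately have "bounded {x. \<psi> (x - a) \<noteq> 0}" by (rule bounded_subset)
  then show ?thesis
    using assms by (simp add: test_functions_def times_continuously_differentiable_translate compact_closure)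
qed

section \<open>Weak gradients and translations\<close>

text \<open>
  The counterpart of \<open>locally_integrable\<close> for Borel representatives. Borel functions
  remain measurable after composition with maps such as \<open>(t, x) \<mapsto> x + t *\<^sub>R
  z\<close>, which is what Fubini's theorem requires below.
\<close>

definition borel_locally_integrable :: "('a::euclidean_space \<Rightarrow> real) \<Rightarrow> bool" where
  "borel_locally_integrable f \<longleftrightarrow> f \<in> borel_measurable borel \<and>
     (\<forall>R. integrable lborel (\<lambda>x. indicator (cball 0 R) x * f x))"

lemma cball_in_sets_borel [measurable]: "cball (a :: 'a::metric_space) r \<in> sets borel"
  by (simp add: borel_closed)

lemma borel_locally_integrable_times_bounded:
  fixes f \<eta> :: "'a::euclidean_space \<Rightarrow> real"
  assumes f: "borel_locally_integrable f" and [measurable]: "\<eta> \<in> borel_measurable borel"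
    and B: "\<And>x. \<bar>\<eta> x\<bar> \<le> B" and R: "\<And>x. R < norm x \<Longrightarrow> \<eta> x = 0"
  shows "integrable lborel (\<lambda>x. f x * \<eta> x)"
proof (rule Bochner_Integration.integrable_bound)
  have [measurable]: "f \<in> borel_measurable borel" using f by (simp add: borel_locally_integrable_def)
  show "integrable lborel (\<lambda>x. B * (indicator (cball 0 R) x * f x))"
    using f by (simp add: borel_locally_integrable_def)
  show "(\<lambda>x. f x * \<eta> x) \<in> borel_measurable lborel" by measurable
  show "AE x in lborel. norm (f x * \<eta> x) \<le> norm (B * (indicator (cball 0 R) x * f x))"
  proof (rule AE_I2)
    fix x
    have "\<bar>\<eta> x\<bar> \<le> \<bar>B\<bar>" using B[of x] by linarith
    then show "norm (f x * \<eta> x) \<le> norm (B * (indicator (cball 0 R) x * f x))"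
      using R[of x] mult_right_mono[of "\<bar>\<eta> x\<bar>" "\<bar>B\<bar>" "\<bar>f x\<bar>"]
      by (cases "R < norm x") (auto simp: abs_mult mult.commute)
  qed
qed

lemma borel_locally_integrable_diff:
  assumes "borel_locally_integrable f" "borel_locally_integrable g"
  shows "borel_locally_integrable (\<lambda>x. f x - g x)"
  using assms unfolding borel_locally_integrable_def by (auto simp: right_diff_distrib)

lemma borel_locally_integrable_of_Lp:
  fixes f :: "'a::euclidean_space \<Rightarrow> real"
  assumes [measurable]: "f \<in> borel_measurable borel" and p: "1 \<le> p"
    and fin: "(\<integral>\<^sup>+x. ennreal (\<bar>f x\<bar> powr p) \<partial>lborel) < \<infinity>"
  shows "borel_locally_integrable f"
  unfolding borel_locally_integrable_def
proof (intro conjI allI)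
  fix R :: real
  have "integrable lborel (\<lambda>x. \<bar>f x\<bar> powr p)" using fin by (simp add: integrable_iff_bounded)
  moreover have "integrable lborel (indicator (cball (0::'a) R) :: 'a \<Rightarrow> real)"
    using emeasure_bounded_finite[OF bounded_cball, of 0 R]
    by (intro integrable_real_indicator) auto
  ultimately have "integrable lborel (\<lambda>x. indicator (cball 0 R) x + \<bar>f x\<bar> powr p)"
    by (intro Bochner_Integration.integrable_add)
  then show "integrable lborel (\<lambda>x. indicator (cball 0 R) x * f x)"
  proof (rule Bochner_Integration.integrable_bound)
    show "AE x in lborel. norm (indicator (cball 0 R) x * f x) \<le> norm (indicator (cball 0 R) x + \<bar>f x\<bar> powr p)"
      using abs_le_one_plus_abs_powr[OF p] by (intro AE_I2) (auto split: split_indicator)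
  qed measurable
qed measurable

text \<open>
  The fundamental lemma of the calculus of variations. By dominated convergence along the bumps, the
  integral of \<open>h\<close> over every open box is zero. So the measures with densities
  \<open>h\<^sup>+\<close> and \<open>h\<^sup>-\<close> agree on a generator that is stable under
  intersection, and densities are unique.
\<close>

lemma AE_zero_if_integral_test_functions_zero:
  fixes h :: "real ^ 'd \<Rightarrow> real"
  assumes h: "borel_locally_integrable h"
    and zero: "\<And>\<psi>. \<psi> \<in> test_functions \<Longrightarrow> (\<integral>x. h x * \<psi> x \<partial>lborel) = 0"
  shows "AE x in lborel. h x = 0"
proof -
  have hm[measurable]: "h \<in> borel_measurable borel" using h by (simp add: borel_locally_integrable_def)
  have boxes: "integrable lborel (\<lambda>x. h x * indicator (box a b) x)"
    "(\<integral>x. h x * indicator (box a b) x \<partial>lborel) = 0" for a b :: "real ^ 'd"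
  proof -
    obtain R where R: "box a b \<subseteq> cball 0 R"
      using bounded_box[of a b] unfolding bounded_iff by (auto simp: subset_iff)
    show int: "integrable lborel (\<lambda>x. h x * indicator (box a b) x)"
      by (rule borel_locally_integrable_times_bounded[OF h, of _ 1 R]) (use R in \<open>auto split: split_indicator\<close>)
    have "(\<lambda>n. \<integral>x. h x * box_bump n a b x \<partial>lborel) \<longlonglongrightarrow> (\<integral>x. h x * indicator (box a b) x \<partial>lborel)"
    proof (rule integral_dominated_convergence)
      show "integrable lborel (\<lambda>x. \<bar>h x * indicator (box a b) x\<bar>)" using int by simp
      have [measurable]: "box_bump n a b \<in> borel_measurable borel" for n
        by (intro borel_measurable_continuous_onI test_function_continuous box_bump_in_test_functions)
      show "(\<lambda>x. h x * box_bump n a b x) \<in> borel_measurable lborel" for n by measurable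
      show "AE x in lborel. (\<lambda>n. h x * box_bump n a b x) \<longlonglongrightarrow> h x * indicator (box a b) x"
        by (intro AE_I2 tendsto_mult tendsto_const tendsto_box_bump)
      show "AE x in lborel. norm (h x * box_bump n a b x) \<le> \<bar>h x * indicator (box a b) x\<bar>" for n
      proof (rule AE_I2)
        fix x
        show "norm (h x * box_bump n a b x) \<le> \<bar>h x * indicator (box a b) x\<bar>"
          using box_bump_outside[of x a b n] box_bump_bounds[of n a b x] mult_left_le[of "box_bump n a b x" "\<bar>h x\<bar>"]
          by (cases "x \<in> box a b") (auto simp: abs_mult)
      qed
    qed measurable
    then have "(\<lambda>n. 0) \<longlonglongrightarrow> (\<integral>x. h x * indicator (box a b) x \<partial>lborel)"
      using zero[OF box_bump_in_test_functions] by simp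
    then show "(\<integral>x. h x * indicator (box a b) x \<partial>lborel) = 0"
      using LIMSEQ_unique tendsto_const by blast
  qed
  define M where "M = density lborel (\<lambda>x. ennreal (h x))"
  define N where "N = density lborel (\<lambda>x. ennreal (- h x))"
  have M: "emeasure M (box a b) = (\<integral>\<^sup>+x. ennreal (h x * indicator (box a b) x) \<partial>lborel)" for a b
    unfolding M_def by (subst emeasure_density) (auto intro!: nn_integral_cong split: split_indicator)
  have N: "emeasure N (box a b) = (\<integral>\<^sup>+x. ennreal (- (h x * indicator (box a b) x)) \<partial>lborel)" for a b
    unfolding N_def by (subst emeasure_density) (auto intro!: nn_integral_cong split: split_indicator)
  have eq: "emeasure M (box a b) = emeasure N (box a b)" and fin: "emeasure M (box a b) \<noteq> \<infinity>" for a b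
  proof -
    define P where "P = (\<integral>\<^sup>+x. ennreal (h x * indicator (box a b) x) \<partial>lborel)"
    define Q where "Q = (\<integral>\<^sup>+x. ennreal (- (h x * indicator (box a b) x)) \<partial>lborel)"
    have "P \<noteq> \<infinity>" "Q \<noteq> \<infinity>"
      using boxes(1)[of a b] unfolding real_integrable_def P_def Q_def by auto
    moreover have "enn2real P = enn2real Q"
      using real_lebesgue_integral_def[OF boxes(1)[of a b]] boxes(2)[of a b] by (simp add: P_def Q_def)
    ultimately show "emeasure M (box a b) = emeasure N (box a b)" "emeasure M (box a b) \<noteq> \<infinity>"
      unfolding M N P_def[symmetric] Q_def[symmetric] by (cases P; cases Q; simp)+
  qed
  have "M = N"
  proof (rule measure_eqI_generator_eq)
    let ?E = "range (\<lambda>(a, b). box a b::(real ^ 'd) set)"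
    show "Int_stable ?E" by (auto simp: Int_stable_def box_Int_box)
    show "?E \<subseteq> Pow UNIV" "sets M = sigma_sets UNIV ?E" "sets N = sigma_sets UNIV ?E"
      by (simp_all add: borel_eq_box M_def N_def)
    let ?A = "\<lambda>n::nat. box (- (real n *\<^sub>R One)) (real n *\<^sub>R One) :: (real ^ 'd) set"
    show "range ?A \<subseteq> ?E" "(\<Union>i. ?A i) = UNIV" unfolding UN_box_eq_UNIV by auto
    show "emeasure M (?A i) \<noteq> \<infinity>" for i by (rule fin)
    show "emeasure M X = emeasure N X" if "X \<in> ?E" for X using that eq by auto
  qed
  then have "AE x in lborel. ennreal (h x) = ennreal (- h x)"
    unfolding M_def N_def by (subst (asm) sigma_finite_measure.density_unique_iff[OF sigma_finite_lborel]) auto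
  then show ?thesis
  proof eventually_elim
    fix x assume "ennreal (h x) = ennreal (- h x)"
    then show "h x = 0" by (cases "0 \<le> h x") (auto simp: ennreal_eq_0_iff ennreal_neg dest: sym)
  qed
qed

lemma locally_integrable_imp_measurable:
  assumes "locally_integrable f"
  shows "f \<in> borel_measurable lebesgue"
proof (rule borel_measurable_LIMSEQ_real)
  show "(\<lambda>x. indicator (cball 0 (real n)) x *\<^sub>R f x) \<in> borel_measurable lebesgue" for n
  proof (rule borel_measurable_integrable)
    show "integrable lebesgue (\<lambda>x. indicator (cball 0 (real n)) x *\<^sub>R f x)"
      using assms compact_cball unfolding locally_integrable_def set_integrable_def by blast
  qed
  show "(\<lambda>n. indicator (cball 0 (real n)) x *\<^sub>R f x) \<longlonglongrightarrow> f x" for x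
  proof (rule tendsto_eventually)
    obtain n0 where "norm x \<le> real n0" using real_arch_simple by blast
    then have "\<forall>n\<ge>n0. indicator (cball 0 (real n)) x *\<^sub>R f x = f x" by auto
    then show "\<forall>\<^sub>F n in sequentially. indicator (cball 0 (real n)) x *\<^sub>R f x = f x"
      unfolding eventually_sequentially by blast
  qed
qed

lemma integral_lebesgue_eq_lborel_AE:
  fixes f f' :: "'a::euclidean_space \<Rightarrow> real"
  assumes "f \<in> borel_measurable lebesgue" "f' \<in> borel_measurable borel" "AE x in lborel. f x = f' x"
  shows "(\<integral>x. f x \<partial>lebesgue) = (\<integral>x. f' x \<partial>lborel)"
    and "integrable lebesgue f \<longleftrightarrow> integrable lborel f'"
proof -
  have m: "f' \<in> borel_measurable lebesgue"
    using assms(2) by (simp add: measurable_completion)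
  have ae: "AE x in lebesgue. f x = f' x"
    using assms(3) by (rule AE_completion)
  have "(\<integral>x. f x \<partial>lebesgue) = (\<integral>x. f' x \<partial>lebesgue)"
    using assms(1) m ae by (rule integral_cong_AE)
  then show "(\<integral>x. f x \<partial>lebesgue) = (\<integral>x. f' x \<partial>lborel)"
    using assms(2) by (simp add: integral_completion)
  have "integrable lebesgue f \<longleftrightarrow> integrable lebesgue f'"
    using assms(1) m ae by (rule integrable_cong_AE)
  then show "integrable lebesgue f \<longleftrightarrow> integrable lborel f'"
    using assms(2) by (simp add: integrable_completion)
qed

lemma locally_integrable_AE_borel:
  fixes f f' :: "real ^ 'd \<Rightarrow> real"
  assumes f: "locally_integrable f" and f'[measurable]: "f' \<in> borel_measurable borel"
    and ae: "AE x in lborel. f x = f' x"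
  shows "borel_locally_integrable f'"
  unfolding borel_locally_integrable_def
proof (intro conjI allI)
  fix R
  have int: "integrable lebesgue (\<lambda>x. indicator (cball 0 R) x *\<^sub>R f x)"
    using f compact_cball unfolding locally_integrable_def set_integrable_def by blast
  have "AE x in lborel. indicator (cball 0 R) x *\<^sub>R f x = indicator (cball 0 R) x * f' x"
    using ae by eventually_elim simp
  from integral_lebesgue_eq_lborel_AE(2)[OF borel_measurable_integrable[OF int] _ this] int
  show "integrable lborel (\<lambda>x. indicator (cball 0 R) x * f' x)" by simp
qed fact

lemma integral_times_test_lebesgue_eq_lborel:
  fixes f f' \<psi> :: "real ^ 'd \<Rightarrow> real"
  assumes f: "locally_integrable f" and f'[measurable]: "f' \<in> borel_measurable borel"
    and ae: "AE x in lborel. f x = f' x" and \<psi>: "continuous_on UNIV \<psi>"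
  shows "(\<integral>x. f x * \<psi> x \<partial>lebesgue) = (\<integral>x. f' x * \<psi> x \<partial>lborel)"
proof (rule integral_lebesgue_eq_lborel_AE(1))
  have [measurable]: "\<psi> \<in> borel_measurable borel" by (rule borel_measurable_continuous_onI[OF \<psi>])
  have "\<psi> \<in> borel_measurable lebesgue" by (simp add: measurable_completion)
  then show "(\<lambda>x. f x * \<psi> x) \<in> borel_measurable lebesgue"
    using locally_integrable_imp_measurable[OF f] by (intro borel_measurable_times)
  show "(\<lambda>x. f' x * \<psi> x) \<in> borel_measurable borel" by measurable
  show "AE x in lborel. f x * \<psi> x = f' x * \<psi> x" using ae by eventually_elim simp
qed

text \<open>
  This makes the choice in \<open>weak_partial\<close> harmless: it agrees almost everywhere with a
  weak derivative in \<open>L\<^sub>p\<close> if there is one.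
\<close>

lemma has_weak_partial_unique:
  assumes g: "has_weak_partial f k g" and h: "has_weak_partial f k h"
  shows "AE x in lborel. g x = h x"
proof -
  obtain g' where g': "g' \<in> borel_measurable lborel" "AE x in lborel. g x = g' x"
    using completion_ex_borel_measurable_real locally_integrable_imp_measurable g
    unfolding has_weak_partial_def by blast
  obtain h' where h': "h' \<in> borel_measurable lborel" "AE x in lborel. h x = h' x"
    using completion_ex_borel_measurable_real locally_integrable_imp_measurable h
    unfolding has_weak_partial_def by blast
  have li: "borel_locally_integrable g'" "borel_locally_integrable h'"
    using locally_integrable_AE_borel g h g' h' unfolding has_weak_partial_def by auto
  have "AE x in lborel. g' x - h' x = 0"
  proof (rule AE_zero_if_integral_test_functions_zero)
    show "borel_locally_integrable (\<lambda>x. g' x - h' x)"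
      using li by (rule borel_locally_integrable_diff)
    fix \<psi> :: "real ^ 'a \<Rightarrow> real" assume \<psi>: "\<psi> \<in> test_functions"
    note cont = test_function_continuous[OF \<psi>]
    obtain R where R: "\<And>x. R < norm x \<Longrightarrow> \<psi> x = 0" using test_function_support[OF \<psi>] by metis
    obtain B where B: "\<And>x. \<bar>\<psi> x\<bar> \<le> B" using continuous_bounded_support_bounded[OF cont R] by metis
    have "(\<integral>x. g x * \<psi> x \<partial>lebesgue) = (\<integral>x. h x * \<psi> x \<partial>lebesgue)"
      using g h \<psi> unfolding has_weak_partial_def by (metis neg_equal_iff_equal)
    then have "(\<integral>x. g' x * \<psi> x \<partial>lborel) = (\<integral>x. h' x * \<psi> x \<partial>lborel)"
      using integral_times_test_lebesgue_eq_lborel[of g g' \<psi>] integral_times_test_lebesgue_eq_lborel[of h h' \<psi>]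
        g h g' h' cont unfolding has_weak_partial_def by simp
    moreover have "integrable lborel (\<lambda>x. g' x * \<psi> x)" "integrable lborel (\<lambda>x. h' x * \<psi> x)"
      using li by (auto intro!: borel_locally_integrable_times_bounded[of _ \<psi> B R] R B borel_measurable_continuous_onI cont)
    ultimately show "(\<integral>x. (g' x - h' x) * \<psi> x \<partial>lborel) = 0"
      by (simp add: left_diff_distrib)
  qed
  then show ?thesis using g'(2) h'(2) by eventually_elim simp
qed

text \<open>
  Lebesgue measure on the unit interval, kept on the whole real line so that its measurable sets are
  the Borel sets.
\<close>

definition unit_interval_measure :: "real measure" where
  "unit_interval_measure = density lborel (\<lambda>t. ennreal (indicator {0..1} t))"

lemma sets_unit_interval_measure [simp, measurable_cong]: "sets unit_interval_measure = sets borel"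
  by (simp add: unit_interval_measure_def)

lemma space_unit_interval_measure [simp]: "space unit_interval_measure = UNIV"
  by (simp add: unit_interval_measure_def)

lemma emeasure_unit_interval_measure: "emeasure unit_interval_measure UNIV = 1"
  by (simp add: unit_interval_measure_def emeasure_density ennreal_indicator)

interpretation unit_interval: finite_measure unit_interval_measure
  by standard (simp add: emeasure_unit_interval_measure)

interpretation unit_interval_lborel: pair_sigma_finite unit_interval_measure "lborel :: 'a::euclidean_space measure" ..

lemma AE_unit_interval_measure: "AE t in unit_interval_measure. 0 \<le> t \<and> t \<le> 1"
  unfolding unit_interval_measure_def by (subst AE_density) (auto split: split_indicator)

lemma integral_unit_interval_measure_FTC:
  fixes F f :: "real \<Rightarrow> real"
  assumes F: "\<And>t. (F has_real_derivative f t) (at t)" and f: "continuous_on UNIV f"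
  shows "(\<integral>t. f t \<partial>unit_interval_measure) = F 1 - F 0"
proof -
  have "(\<integral>t. f t \<partial>unit_interval_measure) = (\<integral>t. indicator {0..1} t *\<^sub>R f t \<partial>lborel)"
    unfolding unit_interval_measure_def
    using borel_measurable_continuous_onI[OF f] by (subst integral_density) auto
  also have "\<dots> = F 1 - F 0"
    using F f by (intro integral_FTC_atLeastAtMost)
      (auto simp: has_real_derivative_iff_has_vector_derivative intro: has_vector_derivative_at_within continuous_on_subset)
  finally show ?thesis .
qed

lemma integrable_unit_interval_lborel:
  fixes A :: "real \<Rightarrow> 'a::euclidean_space \<Rightarrow> real"
  assumes [measurable]: "(\<lambda>(t, x). A t x) \<in> borel_measurable (borel \<Otimes>\<^sub>M borel)"
    and c: "\<And>t. 0 \<le> t \<Longrightarrow> t \<le> 1 \<Longrightarrow> (\<integral>\<^sup>+x. ennreal \<bar>A t x\<bar> \<partial>lborel) \<le> ennreal c"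
  shows "integrable (unit_interval_measure \<Otimes>\<^sub>M lborel) (\<lambda>(t, x). A t x)"
proof (rule integrableI_bounded)
  have "(\<integral>\<^sup>+p. ennreal (norm (case p of (t, x) \<Rightarrow> A t x)) \<partial>(unit_interval_measure \<Otimes>\<^sub>M lborel))
    = (\<integral>\<^sup>+t. \<integral>\<^sup>+x. ennreal \<bar>A t x\<bar> \<partial>lborel \<partial>unit_interval_measure)"
    by (subst lborel.nn_integral_fst[symmetric]) auto
  also have "\<dots> \<le> (\<integral>\<^sup>+t. ennreal c \<partial>unit_interval_measure)"
  proof (rule nn_integral_mono_AE)
    show "AE t in unit_interval_measure. (\<integral>\<^sup>+x. ennreal \<bar>A t x\<bar> \<partial>lborel) \<le> ennreal c"
      using AE_unit_interval_measure by eventually_elim (simp add: c)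
  qed
  also have "\<dots> < \<infinity>" by (simp add: emeasure_unit_interval_measure)
  finally show "(\<integral>\<^sup>+p. ennreal (norm (case p of (t, x) \<Rightarrow> A t x)) \<partial>(unit_interval_measure \<Otimes>\<^sub>M lborel)) < \<infinity>" .
qed measurable

text \<open>
  These justify the two applications of Fubini's theorem in the next lemma: the first to the
  gradient and a test function, the second to \<open>f\<close> and a directional derivative of the
  test function.
\<close>

lemma integrable_segment_translate:
  fixes F \<eta> :: "'a::euclidean_space \<Rightarrow> real"
  assumes F: "borel_locally_integrable F" and [measurable]: "\<eta> \<in> borel_measurable borel"
    and B: "\<And>x. \<bar>\<eta> x\<bar> \<le> B" and R: "\<And>x. R < norm x \<Longrightarrow> \<eta> x = 0"
  shows "integrable (unit_interval_measure \<Otimes>\<^sub>M lborel) (\<lambda>(t, x). F (x + t *\<^sub>R z) * \<eta> x)"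
    and "integrable (unit_interval_measure \<Otimes>\<^sub>M lborel) (\<lambda>(t, x). F x * \<eta> (x - t *\<^sub>R z))"
proof -
  have [measurable]: "F \<in> borel_measurable borel" using F by (simp add: borel_locally_integrable_def)
  define h where "h = (\<lambda>x. B * (indicator (cball 0 (R + norm z)) x * F x))"
  have h: "integrable lborel h" using F by (simp add: h_def borel_locally_integrable_def)
  define c where "c = (\<integral>x. \<bar>h x\<bar> \<partial>lborel)"
  have ch: "(\<integral>\<^sup>+x. ennreal \<bar>h x\<bar> \<partial>lborel) = ennreal c"
    unfolding c_def using h by (intro nn_integral_eq_integral) auto
  have *: "(\<integral>\<^sup>+x. ennreal \<bar>F x * \<eta> (x - t *\<^sub>R z)\<bar> \<partial>lborel) \<le> ennreal c" if t: "0 \<le> t" "t \<le> 1" for t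
    unfolding ch[symmetric]
  proof (intro nn_integral_mono ennreal_leI)
    fix x
    have B': "\<bar>\<eta> (x - t *\<^sub>R z)\<bar> \<le> \<bar>B\<bar>" using B[of "x - t *\<^sub>R z"] by linarith
    show "\<bar>F x * \<eta> (x - t *\<^sub>R z)\<bar> \<le> \<bar>h x\<bar>"
    proof (cases "R + norm z < norm x")
      case True
      have "norm x \<le> norm (x - t *\<^sub>R z) + norm (t *\<^sub>R z)"
        using norm_triangle_ineq[of "x - t *\<^sub>R z" "t *\<^sub>R z"] by simp
      moreover have "norm (t *\<^sub>R z) \<le> norm z" using t by (simp add: mult_left_le_one_le)
      ultimately have "R < norm (x - t *\<^sub>R z)" using True by linarith
      then show ?thesis using R by simp
    next
      case False
      then show ?thesis
        using mult_left_mono[OF B', of "\<bar>F x\<bar>"] by (simp add: h_def abs_mult mult.commute)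
    qed
  qed
  show "integrable (unit_interval_measure \<Otimes>\<^sub>M lborel) (\<lambda>(t, x). F x * \<eta> (x - t *\<^sub>R z))"
    by (rule integrable_unit_interval_lborel[OF _ *]) measurable
  show "integrable (unit_interval_measure \<Otimes>\<^sub>M lborel) (\<lambda>(t, x). F (x + t *\<^sub>R z) * \<eta> x)"
  proof (rule integrable_unit_interval_lborel)
    fix t :: real assume t: "0 \<le> t" "t \<le> 1"
    have "(\<integral>\<^sup>+x. ennreal \<bar>F (x + t *\<^sub>R z) * \<eta> x\<bar> \<partial>lborel) = (\<integral>\<^sup>+x. ennreal \<bar>F x * \<eta> (x - t *\<^sub>R z)\<bar> \<partial>lborel)"
      using nn_integral_lborel_plus[of "\<lambda>x. ennreal \<bar>F x * \<eta> (x - t *\<^sub>R z)\<bar>" "t *\<^sub>R z"] by simp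
    then show "(\<integral>\<^sup>+x. ennreal \<bar>F (x + t *\<^sub>R z) * \<eta> x\<bar> \<partial>lborel) \<le> ennreal c" using *[OF t] by simp
  qed measurable
qed

text \<open>
  The fundamental theorem of calculus along segments, for weak gradients. Tested against
  \<open>\<psi>\<close>, the translations and the weak derivatives move to \<open>\<psi>\<close>,
  and the claim becomes the classical identity \<open>\<psi> x - \<psi> (x - z) =
  \<integral>\<^sub>0\<^sup>1 z \<bullet> \<nabla>\<psi>(x - t z) dt\<close>.
\<close>

lemma weak_gradient_segment_integral:
  fixes f :: "real ^ 'd \<Rightarrow> real" and G :: "real ^ 'd \<Rightarrow> real ^ 'd"
  assumes f: "borel_locally_integrable f" and G: "\<And>k. borel_locally_integrable (\<lambda>x. G x $ k)"
    and weak: "\<And>\<psi> k. \<psi> \<in> test_functions \<Longrightarrow>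
      (\<integral>x. f x * partial k \<psi> x \<partial>lborel) = - (\<integral>x. G x $ k * \<psi> x \<partial>lborel)"
  shows "AE x in lborel. f (x + z) - f x = (\<integral>t. z \<bullet> G (x + t *\<^sub>R z) \<partial>unit_interval_measure)"
proof -
  have [measurable]: "f \<in> borel_measurable borel" using f by (simp add: borel_locally_integrable_def)
  have Gk[measurable]: "(\<lambda>x. G x $ k) \<in> borel_measurable borel" for k
    using G by (simp add: borel_locally_integrable_def)
  define F where "F = (\<lambda>x. z \<bullet> G x)"
  have Fsum: "F x = (\<Sum>k\<in>UNIV. z $ k * G x $ k)" for x by (simp add: F_def inner_vec_def)
  have Fm[measurable]: "F \<in> borel_measurable borel" unfolding Fsum[abs_def] by measurable
  have F: "borel_locally_integrable F"
    unfolding borel_locally_integrable_def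
  proof (intro conjI allI)
    fix R
    have "integrable lborel (\<lambda>x. \<Sum>k\<in>UNIV. z $ k * (indicator (cball 0 R) x * G x $ k))"
      using G by (simp add: borel_locally_integrable_def)
    then show "integrable lborel (\<lambda>x. indicator (cball 0 R) x * F x)"
      by (simp add: Fsum sum_distrib_left mult.left_commute)
  qed fact
  define D where "D = (\<lambda>x. \<integral>t. F (x + t *\<^sub>R z) \<partial>unit_interval_measure)"
  have [measurable]: "D \<in> borel_measurable borel"
    unfolding D_def by measurable
  have D: "borel_locally_integrable D"
    unfolding borel_locally_integrable_def
  proof (intro conjI allI)
    fix R :: real
    have "integrable (unit_interval_measure \<Otimes>\<^sub>M lborel) (\<lambda>(t, x). F (x + t *\<^sub>R z) * indicator (cball 0 R) x)"
      by (rule integrable_segment_translate(1)[OF F borel_measurable_indicator[OF borel_closed[OF closed_cball]], where B=1 and R=R])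
        (auto split: split_indicator)
    from unit_interval_lborel.integrable_snd[OF this]
    show "integrable lborel (\<lambda>x. indicator (cball 0 R) x * D x)"
      by (simp add: D_def mult.commute)
  qed fact
  have f_shift: "borel_locally_integrable (\<lambda>x. f (x + z))"
    unfolding borel_locally_integrable_def
  proof (intro conjI allI)
    fix R :: real
    have 1: "integrable lborel (\<lambda>x. f x * indicator (cball z R) x)"
    proof (rule borel_locally_integrable_times_bounded[OF f, of _ 1 "R + norm z"])
      fix x :: "real ^ 'd" assume "R + norm z < norm x"
      then have "R < norm (x - z)" using norm_triangle_ineq2[of x z] by linarith
      then show "indicator (cball z R) x = (0::real)" by (simp add: dist_norm norm_minus_commute)
    qed (auto split: split_indicator)
    \<comment> \<open>Integrability is transported along the translation, under which Lebesgue measure is invariant.\<close>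
    have "integrable (distr lborel borel ((+) z)) (\<lambda>x. f x * indicator (cball z R) x)"
      using 1 by (simp add: lborel_distr_plus)
    then have "integrable lborel (\<lambda>x. f (z + x) * indicator (cball z R) (z + x))"
      by (subst (asm) integrable_distr_eq) auto
    moreover have "f (z + x) * indicator (cball z R) (z + x) = indicator (cball 0 R) x * f (x + z)" for x
      by (auto simp: dist_norm add.commute split: split_indicator)
    ultimately show "integrable lborel (\<lambda>x. indicator (cball 0 R) x * f (x + z))" by simp
  qed measurable
  have "AE x in lborel. (f (x + z) - f x) - D x = 0"
  proof (rule AE_zero_if_integral_test_functions_zero)
    show "borel_locally_integrable (\<lambda>x. (f (x + z) - f x) - D x)"
      by (intro borel_locally_integrable_diff f_shift f D)
    fix \<psi> :: "real ^ 'd \<Rightarrow> real" assume \<psi>: "\<psi> \<in> test_functions"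
    note cont = test_function_continuous[OF \<psi>] and pcont = test_function_continuous_partial[OF \<psi>]
    obtain R where R: "\<And>x. R < norm x \<Longrightarrow> \<psi> x = 0" "\<And>x k. R < norm x \<Longrightarrow> partial k \<psi> x = 0"
      using test_function_support[OF \<psi>] by metis
    obtain B where B: "\<And>x. \<bar>\<psi> x\<bar> \<le> B" using continuous_bounded_support_bounded[OF cont R(1)] by metis
    define E where "E = (\<lambda>x. \<Sum>k\<in>UNIV. z $ k * partial k \<psi> x)"
    have Econt: "continuous_on UNIV E" unfolding E_def by (intro continuous_intros pcont)
    have ER: "E x = 0" if "R < norm x" for x using R(2)[OF that] by (simp add: E_def)
    obtain B' where B': "\<And>x. \<bar>E x\<bar> \<le> B'" using continuous_bounded_support_bounded[OF Econt ER] by metis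
    have [measurable]: "\<psi> \<in> borel_measurable borel" "E \<in> borel_measurable borel"
      by (intro borel_measurable_continuous_onI cont Econt)+
    have int: "integrable lborel (\<lambda>x. h x * \<psi> x)" if "borel_locally_integrable h" for h
      by (rule borel_locally_integrable_times_bounded[OF that _ B R(1)]) measurable
    have intS: "integrable lborel (\<lambda>x. f x * \<psi> (x - z))"
    proof (rule borel_locally_integrable_times_bounded[OF f _ B])
      fix x :: "real ^ 'd" assume "R + norm z < norm x"
      then have "R < norm (x - z)" using norm_triangle_ineq2[of x z] by linarith
      then show "\<psi> (x - z) = 0" by (rule R)
    qed measurable
    have ftc: "(\<integral>t. E (x - t *\<^sub>R z) \<partial>unit_interval_measure) = \<psi> x - \<psi> (x - z)" for x
    proof -
      have "((\<lambda>t. - \<psi> (x - t *\<^sub>R z)) has_real_derivative E (x - t *\<^sub>R z)) (at t)" for t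
      proof -
        have "((\<lambda>t. x - t *\<^sub>R z) has_derivative (\<lambda>h. - (h *\<^sub>R z))) (at t)"
          by (auto intro!: derivative_eq_intros)
        then have "((\<lambda>t. \<psi> (x - t *\<^sub>R z)) has_derivative
            (\<lambda>h. \<Sum>k\<in>UNIV. (- (h *\<^sub>R z)) $ k * partial k \<psi> (x - t *\<^sub>R z))) (at t)"
          by (rule has_derivative_compose[OF _ test_function_has_derivative[OF \<psi>]])
        moreover have "(\<lambda>h. \<Sum>k\<in>UNIV. (- (h *\<^sub>R z)) $ k * partial k \<psi> (x - t *\<^sub>R z)) = (*) (- E (x - t *\<^sub>R z))"
          by (auto simp: E_def sum_negf sum_distrib_left sum_distrib_right mult_ac)
        ultimately have "((\<lambda>t. \<psi> (x - t *\<^sub>R z)) has_real_derivative - E (x - t *\<^sub>R z)) (at t)"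
          by (simp add: has_field_derivative_def)
        from DERIV_minus[OF this] show ?thesis by simp
      qed
      moreover have "continuous_on UNIV (\<lambda>t. E (x - t *\<^sub>R z))"
        by (rule continuous_on_compose2[OF Econt]) (auto intro!: continuous_intros)
      ultimately have "(\<integral>t. E (x - t *\<^sub>R z) \<partial>unit_interval_measure) = - \<psi> (x - 1 *\<^sub>R z) - - \<psi> (x - 0 *\<^sub>R z)"
        by (rule integral_unit_interval_measure_FTC)
      then show ?thesis by simp
    qed
    have weak': "(\<integral>x. F (x + t *\<^sub>R z) * \<psi> x \<partial>lborel) = - (\<integral>x. f x * E (x - t *\<^sub>R z) \<partial>lborel)" for t
    proof -
      define \<psi>t where "\<psi>t = (\<lambda>x. \<psi> (x - t *\<^sub>R z))"
      have \<psi>t: "\<psi>t \<in> test_functions" unfolding \<psi>t_def by (rule test_function_translate[OF \<psi>])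
      have Et: "E (x - t *\<^sub>R z) = (\<Sum>k\<in>UNIV. z $ k * partial k \<psi>t x)" for x
        using partial_translate[OF test_function_differentiable[OF \<psi>]] by (simp add: E_def \<psi>t_def)
      obtain S where S: "\<And>x. S < norm x \<Longrightarrow> \<psi>t x = 0" "\<And>x k. S < norm x \<Longrightarrow> partial k \<psi>t x = 0"
        using test_function_support[OF \<psi>t] by metis
      have ip: "integrable lborel (\<lambda>x. f x * partial k \<psi>t x)" for k
      proof -
        obtain b where "\<And>x. \<bar>partial k \<psi>t x\<bar> \<le> b"
          using continuous_bounded_support_bounded[OF test_function_continuous_partial[OF \<psi>t] S(2)] by metis
        then show ?thesis
          by (intro borel_locally_integrable_times_bounded[OF f _ _ S(2)]
            borel_measurable_continuous_onI test_function_continuous_partial[OF \<psi>t])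
      qed
      have ig: "integrable lborel (\<lambda>x. G x $ k * \<psi>t x)" for k
        by (rule borel_locally_integrable_times_bounded[OF G _ _ S(1), where B=B])
          (auto simp: \<psi>t_def B)
      have "(\<integral>x. F (x + t *\<^sub>R z) * \<psi> x \<partial>lborel) = (\<integral>x. F x * \<psi>t x \<partial>lborel)"
        using lborel_integral_plus[of "\<lambda>x. F x * \<psi>t x" "t *\<^sub>R z"] by (simp add: \<psi>t_def)
      also have "\<dots> = (\<integral>x. (\<Sum>k\<in>UNIV. z $ k * (G x $ k * \<psi>t x)) \<partial>lborel)"
        by (simp add: Fsum sum_distrib_right mult.assoc)
      also have "\<dots> = (\<Sum>k\<in>UNIV. z $ k * (\<integral>x. G x $ k * \<psi>t x \<partial>lborel))"
        using ig by simp
      also have "\<dots> = - (\<Sum>k\<in>UNIV. z $ k * (\<integral>x. f x * partial k \<psi>t x \<partial>lborel))"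
        by (simp add: weak[OF \<psi>t] sum_negf)
      also have "(\<Sum>k\<in>UNIV. z $ k * (\<integral>x. f x * partial k \<psi>t x \<partial>lborel))
          = (\<integral>x. (\<Sum>k\<in>UNIV. z $ k * (f x * partial k \<psi>t x)) \<partial>lborel)"
        using ip by simp
      also have "\<dots> = (\<integral>x. f x * E (x - t *\<^sub>R z) \<partial>lborel)"
        by (simp add: Et sum_distrib_left mult.left_commute)
      finally show ?thesis .
    qed
    have "(\<integral>x. D x * \<psi> x \<partial>lborel) = (\<integral>x. \<integral>t. F (x + t *\<^sub>R z) * \<psi> x \<partial>unit_interval_measure \<partial>lborel)"
      by (simp add: D_def)
    also have "\<dots> = (\<integral>t. \<integral>x. F (x + t *\<^sub>R z) * \<psi> x \<partial>lborel \<partial>unit_interval_measure)"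
      by (rule unit_interval_lborel.Fubini_integral)
        (rule integrable_segment_translate(1)[where \<eta>=\<psi> and B=B and R=R, OF F _ B R(1)], measurable)
    also have "\<dots> = - (\<integral>t. \<integral>x. f x * E (x - t *\<^sub>R z) \<partial>lborel \<partial>unit_interval_measure)"
      by (simp add: weak')
    also have "(\<integral>t. \<integral>x. f x * E (x - t *\<^sub>R z) \<partial>lborel \<partial>unit_interval_measure)
       = (\<integral>x. \<integral>t. f x * E (x - t *\<^sub>R z) \<partial>unit_interval_measure \<partial>lborel)"
      by (rule unit_interval_lborel.Fubini_integral[symmetric])
        (rule integrable_segment_translate(2)[where \<eta>=E and B=B' and R=R, OF f _ B' ER], measurable)
    also have "\<dots> = (\<integral>x. f x * \<psi> x - f x * \<psi> (x - z) \<partial>lborel)"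
      by (simp add: ftc right_diff_distrib)
    also have "\<dots> = (\<integral>x. f x * \<psi> x \<partial>lborel) - (\<integral>x. f x * \<psi> (x - z) \<partial>lborel)"
      using int[OF f] intS by simp
    also have "(\<integral>x. f x * \<psi> (x - z) \<partial>lborel) = (\<integral>x. f (x + z) * \<psi> x \<partial>lborel)"
      using lborel_integral_plus[of "\<lambda>x. f x * \<psi> (x - z)" z] by simp
    finally show "(\<integral>x. ((f (x + z) - f x) - D x) * \<psi> x \<partial>lborel) = 0"
      using int[OF f_shift] int[OF f] int[OF D] by (simp add: left_diff_distrib)
  qed
  then show ?thesis by eventually_elim (simp add: D_def F_def)
qed

text \<open>
  Jensen's inequality for \<open>dt\<close> on the unit interval, the Cauchy--Schwarz inequality for
  \<open>z \<bullet> G\<close>, and translation invariance.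
\<close>

lemma translation_energy_le_gradient:
  fixes f :: "real ^ 'd \<Rightarrow> real" and G :: "real ^ 'd \<Rightarrow> real ^ 'd"
  assumes p: "1 < p" and f: "borel_locally_integrable f" and G: "\<And>k. borel_locally_integrable (\<lambda>x. G x $ k)"
    and weak: "\<And>\<psi> k. \<psi> \<in> test_functions \<Longrightarrow>
      (\<integral>x. f x * partial k \<psi> x \<partial>lborel) = - (\<integral>x. G x $ k * \<psi> x \<partial>lborel)"
  shows "translation_energy p f z \<le> ennreal (norm z powr p) * (\<integral>\<^sup>+x. ennreal (norm (G x) powr p) \<partial>lborel)"
proof -
  have [measurable]: "f \<in> borel_measurable borel" using f by (simp add: borel_locally_integrable_def)
  have "(\<lambda>x. G x $ k) \<in> borel_measurable borel" for k
    using G by (simp add: borel_locally_integrable_def)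
  then have [measurable]: "G \<in> borel_measurable borel"
    by (subst borel_measurable_euclidean_space) (auto simp: Basis_vec_def inner_axis)
  define A where "A = (\<lambda>t x. (- z) \<bullet> G (x + t *\<^sub>R (- z)))"
  have [measurable]: "(\<lambda>(t, x). A t x) \<in> borel_measurable (borel \<Otimes>\<^sub>M borel)" unfolding A_def by measurable
  have "translation_energy p f z
      \<le> (\<integral>\<^sup>+x. \<integral>\<^sup>+t. ennreal (\<bar>A t x\<bar> powr p) \<partial>unit_interval_measure \<partial>lborel)"
    unfolding translation_energy_def
  proof (rule nn_integral_mono_AE)
    have "AE x in lborel. f (x + - z) - f x = (\<integral>t. A t x \<partial>unit_interval_measure)"
      unfolding A_def using weak_gradient_segment_integral[OF f G weak, of "- z"] by simp
    then show "AE x in lborel. ennreal (\<bar>f (x - z) - f x\<bar> powr p)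
        \<le> (\<integral>\<^sup>+t. ennreal (\<bar>A t x\<bar> powr p) \<partial>unit_interval_measure)"
    proof eventually_elim
      fix x assume eq: "f (x + - z) - f x = (\<integral>t. A t x \<partial>unit_interval_measure)"
      have "ennreal (\<bar>\<integral>t. A t x \<partial>unit_interval_measure\<bar> powr p)
         \<le> ennreal (1 powr (p - 1)) * (\<integral>\<^sup>+t. ennreal (\<bar>A t x\<bar> powr p) \<partial>unit_interval_measure)"
        using p by (intro abs_integral_powr_le unit_interval.finite_measure_axioms)
          (auto simp: measure_def emeasure_unit_interval_measure)
      then show "ennreal (\<bar>f (x - z) - f x\<bar> powr p)
        \<le> (\<integral>\<^sup>+t. ennreal (\<bar>A t x\<bar> powr p) \<partial>unit_interval_measure)"
        using eq by simp
    qed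
  qed
  also have "\<dots> = (\<integral>\<^sup>+t. \<integral>\<^sup>+x. ennreal (\<bar>A t x\<bar> powr p) \<partial>lborel \<partial>unit_interval_measure)"
    by (rule unit_interval_lborel.Fubini') measurable
  also have "\<dots> \<le> (\<integral>\<^sup>+t. ennreal (norm z powr p) * (\<integral>\<^sup>+x. ennreal (norm (G x) powr p) \<partial>lborel) \<partial>unit_interval_measure)"
  proof (rule nn_integral_mono)
    fix t
    have "(\<integral>\<^sup>+x. ennreal (\<bar>A t x\<bar> powr p) \<partial>lborel)
       \<le> (\<integral>\<^sup>+x. ennreal (norm z powr p) * ennreal (norm (G (x + t *\<^sub>R (- z))) powr p) \<partial>lborel)"
    proof (rule nn_integral_mono)
      fix x
      have "\<bar>A t x\<bar> powr p \<le> (norm z * norm (G (x + t *\<^sub>R (- z)))) powr p"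
        using p Cauchy_Schwarz_ineq2[of "- z" "G (x + t *\<^sub>R (- z))"] unfolding A_def
        by (intro powr_mono2) auto
      then show "ennreal (\<bar>A t x\<bar> powr p) \<le> ennreal (norm z powr p) * ennreal (norm (G (x + t *\<^sub>R (- z))) powr p)"
        by (simp add: powr_mult flip: ennreal_mult)
    qed
    also have "\<dots> = ennreal (norm z powr p) * (\<integral>\<^sup>+x. ennreal (norm (G (x + t *\<^sub>R (- z))) powr p) \<partial>lborel)"
      by (rule nn_integral_cmult) measurable
    also have "(\<integral>\<^sup>+x. ennreal (norm (G (x + t *\<^sub>R (- z))) powr p) \<partial>lborel) = (\<integral>\<^sup>+x. ennreal (norm (G x) powr p) \<partial>lborel)"
      by (rule nn_integral_lborel_plus[where f="\<lambda>x. ennreal (norm (G x) powr p)"]) measurable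
    finally show "(\<integral>\<^sup>+x. ennreal (\<bar>A t x\<bar> powr p) \<partial>lborel)
       \<le> ennreal (norm z powr p) * (\<integral>\<^sup>+x. ennreal (norm (G x) powr p) \<partial>lborel)" .
  qed
  also have "\<dots> = ennreal (norm z powr p) * (\<integral>\<^sup>+x. ennreal (norm (G x) powr p) \<partial>lborel)"
    by (simp add: emeasure_unit_interval_measure)
  finally show ?thesis .
qed

section \<open>Passing to Borel representatives and choosing the scale\<close>

lemma Lp_space_AE_borel:
  fixes f f' :: "real ^ 'd \<Rightarrow> real"
  assumes f: "f \<in> Lp_space p" and [measurable]: "f' \<in> borel_measurable borel"
    and ae: "AE x in lborel. f x = f' x"
  shows "(\<integral>\<^sup>+x. ennreal (\<bar>f' x\<bar> powr p) \<partial>lborel) < \<infinity>"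
proof -
  have "(\<integral>\<^sup>+x. ennreal (\<bar>f' x\<bar> powr p) \<partial>lborel) = (\<integral>\<^sup>+x. ennreal (\<bar>f x\<bar> powr p) \<partial>lborel)"
    using ae by (intro nn_integral_cong_AE) (auto elim: eventually_mono)
  also have "\<dots> = (\<integral>\<^sup>+x. ennreal (norm (\<bar>f x\<bar> powr p)) \<partial>lebesgue)"
    by (simp add: nn_integral_completion)
  also have "\<dots> < \<infinity>"
    using f unfolding Lp_space_def integrable_iff_bounded by simp
  finally show ?thesis .
qed

lemma slobodeckij_integral_AE_borel:
  fixes f f' :: "real ^ 'd \<Rightarrow> real"
  assumes ae: "AE x in lborel. f x = f' x"
  shows "slobodeckij_integral s p f = (\<integral>\<^sup>+x. \<integral>\<^sup>+y. ennreal (\<bar>f' x - f' y\<bar> powr p /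
      norm (x - y) powr (real CARD('d) + s * p)) \<partial>lborel \<partial>lborel)"
  unfolding slobodeckij_integral_def nn_integral_completion
proof (rule nn_integral_cong_AE)
  show "AE x in lborel. (\<integral>\<^sup>+y. ennreal (\<bar>f x - f y\<bar> powr p / norm (x - y) powr (real CARD('d) + s * p)) \<partial>lborel)
      = (\<integral>\<^sup>+y. ennreal (\<bar>f' x - f' y\<bar> powr p / norm (x - y) powr (real CARD('d) + s * p)) \<partial>lborel)"
    using ae
  proof eventually_elim
    fix x assume x: "f x = f' x"
    show "(\<integral>\<^sup>+y. ennreal (\<bar>f x - f y\<bar> powr p / norm (x - y) powr (real CARD('d) + s * p)) \<partial>lborel)
      = (\<integral>\<^sup>+y. ennreal (\<bar>f' x - f' y\<bar> powr p / norm (x - y) powr (real CARD('d) + s * p)) \<partial>lborel)"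
      using ae by (intro nn_integral_cong_AE) (auto simp: x elim: eventually_mono)
  qed
qed

lemma norm_vec_powr_le:
  fixes v :: "real ^ 'd"
  assumes "0 \<le> p"
  shows "norm v powr p \<le> real CARD('d) powr p * (\<Sum>k\<in>UNIV. \<bar>v $ k\<bar> powr p)"
proof -
  define M where "M = Max (range (\<lambda>k. \<bar>v $ k\<bar>))"
  have M: "\<bar>v $ k\<bar> \<le> M" for k unfolding M_def by (intro Max_ge) auto
  have "M \<in> range (\<lambda>k. \<bar>v $ k\<bar>)" unfolding M_def by (intro Max_in) auto
  then obtain k0 where k0: "M = \<bar>v $ k0\<bar>" by blast
  have "norm v \<le> (\<Sum>k\<in>UNIV. \<bar>v $ k\<bar>)" by (rule norm_le_l1_cart)
  also have "\<dots> \<le> (\<Sum>k\<in>(UNIV :: 'd set). M)" by (intro sum_mono M)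
  finally have "norm v powr p \<le> (real CARD('d) * M) powr p"
    using assms by (intro powr_mono2) auto
  also have "\<dots> = real CARD('d) powr p * \<bar>v $ k0\<bar> powr p"
    by (simp add: powr_mult k0)
  also have "\<dots> \<le> real CARD('d) powr p * (\<Sum>k\<in>UNIV. \<bar>v $ k\<bar> powr p)"
    by (intro mult_left_mono member_le_sum) auto
  finally show ?thesis .
qed

text \<open>
  The Bochner integral in \<open>sobolev_seminorm\<close> is informative only for an integrable
  function. Uniqueness of weak derivatives provides this: the chosen partial derivatives agree
  almost everywhere with members of \<open>L\<^sub>p\<close>.
\<close>

lemma weak_gradient_AE_borel:
  fixes f :: "real ^ 'd \<Rightarrow> real"
  assumes f: "f \<in> sobolev_space 1 p" and p: "1 \<le> p"
  obtains G :: "real ^ 'd \<Rightarrow> real ^ 'd" where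
    "\<And>k. borel_locally_integrable (\<lambda>x. G x $ k)"
    "\<And>k. has_weak_partial f k (weak_partial k f)"
    "\<And>k. AE x in lborel. weak_partial k f x = G x $ k"
    "(\<integral>\<^sup>+x. ennreal (norm (G x) powr p) \<partial>lborel) = ennreal (sobolev_seminorm 1 p f powr p)"
proof -
  have "\<forall>k. \<exists>g\<in>Lp_space p. has_weak_partial f k g" using f by (simp add: sobolev_space_def)
  then obtain g where g: "\<And>k. g k \<in> Lp_space p" "\<And>k. has_weak_partial f k (g k)" by metis
  have w: "has_weak_partial f k (weak_partial k f)" for k
    unfolding weak_partial_def by (rule someI[of _ "g k"]) (rule g)
  have "\<exists>g'\<in>borel_measurable lborel. AE x in lborel. g k x = g' x" for k
    using g(1)[of k] by (intro completion_ex_borel_measurable_real) (simp add: Lp_space_def)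
  then obtain g' where g': "\<And>k. g' k \<in> borel_measurable lborel" "\<And>k. AE x in lborel. g k x = g' k x"
    by metis
  define G :: "real ^ 'd \<Rightarrow> real ^ 'd" where "G = (\<lambda>x. \<chi> k. g' k x)"
  have Gk: "(\<lambda>x. G x $ k) = g' k" for k by (simp add: G_def)
  have gm[measurable]: "g' k \<in> borel_measurable borel" for k using g'(1)[of k] by simp
  have fin: "(\<integral>\<^sup>+x. ennreal (\<bar>g' k x\<bar> powr p) \<partial>lborel) < \<infinity>" for k
    by (rule Lp_space_AE_borel[OF g(1) gm g'(2)])
  have li: "borel_locally_integrable (\<lambda>x. G x $ k)" for k
    unfolding Gk by (rule borel_locally_integrable_of_Lp[OF gm p fin])
  have ae: "AE x in lborel. weak_partial k f x = G x $ k" for k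
    using has_weak_partial_unique[OF w[of k] g(2)[of k]] g'(2)[of k]
    by eventually_elim (simp add: G_def)
  have Gm[measurable]: "G \<in> borel_measurable borel"
    by (subst borel_measurable_euclidean_space) (auto simp: Basis_vec_def inner_axis Gk)
  have Gint: "integrable lborel (\<lambda>x. norm (G x) powr p)"
  proof (rule Bochner_Integration.integrable_bound)
    have "integrable lborel (\<lambda>x. \<bar>g' k x\<bar> powr p)" for k
      using fin[of k] by (simp add: integrable_iff_bounded)
    then show "integrable lborel (\<lambda>x. real CARD('d) powr p * (\<Sum>k\<in>UNIV. \<bar>g' k x\<bar> powr p))" by simp
    show "AE x in lborel. norm (norm (G x) powr p) \<le> norm (real CARD('d) powr p * (\<Sum>k\<in>UNIV. \<bar>g' k x\<bar> powr p))"
    proof (rule AE_I2)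
      fix x
      show "norm (norm (G x) powr p) \<le> norm (real CARD('d) powr p * (\<Sum>k\<in>UNIV. \<bar>g' k x\<bar> powr p))"
        using norm_vec_powr_le[of p "G x"] p by (simp add: G_def sum_nonneg)
    qed
  qed measurable
  have "(\<integral>x. norm (weak_gradient f x) powr p \<partial>lebesgue) = (\<integral>x. norm (G x) powr p \<partial>lborel)"
  proof (rule integral_lebesgue_eq_lborel_AE(1))
    have "weak_partial k f \<in> borel_measurable lebesgue" for k
      using w[of k] by (intro locally_integrable_imp_measurable) (simp add: has_weak_partial_def)
    then have "weak_gradient f \<in> borel_measurable lebesgue"
      by (subst borel_measurable_euclidean_space) (auto simp: Basis_vec_def inner_axis weak_gradient_def)
    then show "(\<lambda>x. norm (weak_gradient f x) powr p) \<in> borel_measurable lebesgue" by measurable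
    have "AE x in lborel. \<forall>k\<in>UNIV. weak_partial k f x = G x $ k"
      using ae by (subst AE_ball_countable) auto
    then show "AE x in lborel. norm (weak_gradient f x) powr p = norm (G x) powr p"
      by eventually_elim (simp add: weak_gradient_def vec_eq_iff)
  qed measurable
  then have "sobolev_seminorm 1 p f powr p = (\<integral>x. norm (G x) powr p \<partial>lborel)"
    using p by (simp add: sobolev_seminorm_def powr_powr)
  then have "(\<integral>\<^sup>+x. ennreal (norm (G x) powr p) \<partial>lborel) = ennreal (sobolev_seminorm 1 p f powr p)"
    using nn_integral_eq_integral[OF Gint] by simp
  with li w ae show thesis by (rule that)
qed

text \<open>
  The smoothness hypothesis enters the approximation argument only through this estimate. Since
  \<open>c\<close> is chosen before \<open>f\<close>, the final constant depends on \<open>f\<close>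
  through the seminorm alone.
\<close>

lemma translation_energy_le_sobolev_seminorm:
  fixes p s :: real
  assumes p: "1 < p" and s: "0 < s" "s \<le> 1"
  obtains c where "0 \<le> c"
    "\<And>(f :: real ^ 'd \<Rightarrow> real) f' z. f \<in> sobolev_space s p \<Longrightarrow> f' \<in> borel_measurable borel \<Longrightarrow>
      AE x in lborel. f x = f' x \<Longrightarrow>
      translation_energy p f' z \<le> ennreal (c * sobolev_seminorm s p f powr p * norm z powr (s * p))"
proof (cases "s = 1")
  case True
  have "translation_energy p f' z \<le> ennreal (1 * sobolev_seminorm s p f powr p * norm z powr (s * p))"
    if f: "f \<in> sobolev_space s p" and f'm: "f' \<in> borel_measurable borel" and ae: "AE x in lborel. f x = f' x"
    for f f' :: "real ^ 'd \<Rightarrow> real" and z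
  proof -
    have f1: "f \<in> sobolev_space 1 p" using f True by simp
    then have "f \<in> Lp_space p" by (simp add: sobolev_space_def)
    then have f': "borel_locally_integrable f'"
      using p by (intro borel_locally_integrable_of_Lp[OF f'm _ Lp_space_AE_borel[OF _ f'm ae]]) auto
    obtain G :: "real ^ 'd \<Rightarrow> real ^ 'd" where G: "\<And>k. borel_locally_integrable (\<lambda>x. G x $ k)"
      and w: "\<And>k. has_weak_partial f k (weak_partial k f)"
      and aeG: "\<And>k. AE x in lborel. weak_partial k f x = G x $ k"
      and norm: "(\<integral>\<^sup>+x. ennreal (norm (G x) powr p) \<partial>lborel) = ennreal (sobolev_seminorm 1 p f powr p)"
      by (rule weak_gradient_AE_borel[OF f1 less_imp_le[OF p]]) (rule that)
    have "(\<integral>x. f' x * partial k \<psi> x \<partial>lborel) = - (\<integral>x. G x $ k * \<psi> x \<partial>lborel)"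
      if \<psi>: "\<psi> \<in> test_functions" for \<psi> k
    proof -
      have Gm: "(\<lambda>x. G x $ k) \<in> borel_measurable borel"
        using G by (simp add: borel_locally_integrable_def)
      have "(\<integral>x. f' x * partial k \<psi> x \<partial>lborel) = (\<integral>x. f x * partial k \<psi> x \<partial>lebesgue)"
        using w[of k] test_function_continuous_partial[OF \<psi>]
        by (intro integral_times_test_lebesgue_eq_lborel[OF _ f'm ae, symmetric]) (auto simp: has_weak_partial_def)
      also have "\<dots> = - (\<integral>x. weak_partial k f x * \<psi> x \<partial>lebesgue)"
        using w[of k] \<psi> by (simp add: has_weak_partial_def)
      also have "(\<integral>x. weak_partial k f x * \<psi> x \<partial>lebesgue) = (\<integral>x. G x $ k * \<psi> x \<partial>lborel)"
        using w[of k] test_function_continuous[OF \<psi>]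
        by (intro integral_times_test_lebesgue_eq_lborel[OF _ Gm aeG]) (auto simp: has_weak_partial_def)
      finally show ?thesis .
    qed
    then have "translation_energy p f' z \<le> ennreal (norm z powr p) * ennreal (sobolev_seminorm 1 p f powr p)"
      using translation_energy_le_gradient[OF p f' G, of z] by (simp add: norm)
    then show ?thesis using True by (simp add: mult.commute flip: ennreal_mult)
  qed
  then show thesis by (intro that[of 1]) auto
next
  case False
  define c where "c = 2 powr p * 2 ^ CARD('d) / unit_ball_vol (real CARD('d))"
  have c: "0 \<le> c" by (simp add: c_def)
  have "translation_energy p f' z \<le> ennreal (c * sobolev_seminorm s p f powr p * norm z powr (s * p))"
    if f: "f \<in> sobolev_space s p" and f'm: "f' \<in> borel_measurable borel" and ae: "AE x in lborel. f x = f' x"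
    for f f' :: "real ^ 'd \<Rightarrow> real" and z
  proof -
    have "slobodeckij_integral s p f < \<infinity>" using f False by (simp add: sobolev_space_def)
    then have fin: "slobodeckij_integral s p f = ennreal (sobolev_seminorm s p f powr p)"
      using False p by (simp add: sobolev_seminorm_def powr_powr)
    have "translation_energy p f' z \<le> ennreal (c * norm z powr (s * p)) * slobodeckij_integral s p f"
      using translation_energy_le_slobodeckij[OF f'm, of p s z] p s
      unfolding slobodeckij_integral_AE_borel[OF ae] c_def by simp
    then show ?thesis
      unfolding fin using c by (simp add: mult_ac flip: ennreal_mult)
  qed
  with c show thesis by (rule that)
qed

lemma density_AE_borel:
  assumes "f \<in> densities"
  obtains f' where "f' \<in> borel_measurable borel" "\<And>x. 0 \<le> f' x" "AE x in lborel. f x = f' x"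
    "(\<integral>\<^sup>+x. ennreal (f' x) \<partial>lborel) = 1"
proof -
  have f: "f \<in> borel_measurable lebesgue" "\<And>x. 0 \<le> f x" "(\<integral>\<^sup>+x. ennreal (f x) \<partial>lborel) = 1"
    using assms by (auto simp: densities_def nn_integral_completion)
  obtain h where h: "h \<in> borel_measurable lborel" "AE x in lborel. f x = h x"
    using completion_ex_borel_measurable_real[OF f(1)] by blast
  \<comment> \<open>A Borel representative need not be nonnegative everywhere; its positive part is.\<close>
  define f' where "f' = (\<lambda>x. max 0 (h x))"
  have ae: "AE x in lborel. f x = f' x"
    using h(2) by eventually_elim (metis f'_def f(2) max.absorb2)
  show thesis
  proof (rule that)
    show "f' \<in> borel_measurable borel" using h(1) by (simp add: f'_def)
    have "(\<integral>\<^sup>+x. ennreal (f' x) \<partial>lborel) = (\<integral>\<^sup>+x. ennreal (f x) \<partial>lborel)"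
      using ae by (intro nn_integral_cong_AE) (auto elim: eventually_mono)
    then show "(\<integral>\<^sup>+x. ennreal (f' x) \<partial>lborel) = 1" using f(3) by simp
  qed (use ae in \<open>auto simp: f'_def\<close>)
qed

text \<open>
  Needed to compare the components built from \<open>\<phi>\<close> with those built from a Borel
  representative of \<open>\<phi>\<close>.
\<close>

lemma AE_lborel_affine:
  fixes t :: "'a::euclidean_space"
  assumes "AE x in lborel. P x" and c: "c \<noteq> 0"
  shows "AE x in lborel. P (t + c *\<^sub>R x)"
proof -
  obtain N where N: "{x. \<not> P x} \<subseteq> N" "emeasure lborel N = 0" and [measurable]: "N \<in> sets borel"
    using assms(1) by (auto elim: AE_E)
  have "(\<integral>\<^sup>+x. indicator N x \<partial>(lborel :: 'a measure)) = ennreal (\<bar>c\<bar> ^ DIM('a)) * (\<integral>\<^sup>+x. indicator N (t + c *\<^sub>R x) \<partial>lborel)"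
    by (rule nn_integral_lborel_affine[OF _ c]) measurable
  then have "(\<integral>\<^sup>+x. indicator N (t + c *\<^sub>R x) \<partial>(lborel :: 'a measure)) = 0"
    using N(2) c by simp
  then have "AE x in lborel. indicator N (t + c *\<^sub>R x) = (0 :: ennreal)"
    by (subst (asm) nn_integral_0_iff_AE) auto
  then show ?thesis
    by eventually_elim (use N(1) in \<open>auto simp: indicator_eq_0_iff\<close>)
qed

lemma Lp_norm_le:
  assumes le: "(\<integral>\<^sup>+x. ennreal (\<bar>h x\<bar> powr p) \<partial>lborel) \<le> ennreal R" and R: "0 \<le> R" and p: "0 < p"
  shows "Lp_norm p h \<le> R powr (1 / p)"
proof -
  have "(\<integral>x. \<bar>h x\<bar> powr p \<partial>lebesgue) \<le> R"
    using le R by (intro integral_real_bounded) (simp_all add: nn_integral_completion)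
  then show ?thesis
    unfolding Lp_norm_def using p by (intro powr_mono2 integral_nonneg) auto
qed

theorem corollary5:
  fixes p q s K1 :: real and \<phi> :: "real ^ 'd \<Rightarrow> real"
  assumes "1 < p" and "q = p / (p - 1)"
    and "0 < s" and "s \<le> 1"
    and "\<phi> \<in> Lp_space p \<inter> densities"
    and "0 < K1"
    and "(\<integral>\<^sup>+x. ennreal (norm x powr s * \<phi> x) \<partial>lebesgue) \<le> ennreal K1"
  shows "\<exists>K :: real \<Rightarrow> real. \<forall>f0 :: real ^ 'd \<Rightarrow> real.
    f0 \<in> sobolev_space s p \<inter> densities \<longrightarrow>
    (\<exists>f :: nat \<Rightarrow> real ^ 'd \<Rightarrow> real. \<forall>m\<ge>1.
       f m \<in> mixtures m (location_scale_family \<phi>) \<and>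
       Lp_norm p (\<lambda>x. f m x - f0 x) \<le>
         (if p < 2
          then K (sobolev_seminorm s p f0) * real m powr (- (s / (s * q + real CARD('d))))
          else K (sobolev_seminorm s p f0) *
                 real m powr (- (s * q / (2 * (s * q + real CARD('d)))))))"
proof -
  note p = \<open>1 < p\<close> and s = \<open>0 < s\<close> \<open>s \<le> 1\<close> and k = \<open>0 < K1\<close>
  define d where "d = real CARD('d)"
  have d: "0 < d" by (simp add: d_def)
  define r where "r = max 1 (p / 2)"
  obtain C where bound: "second_order_powr_bound p C"
    using second_order_powr_bound_exists[OF p] by blast
  then have C: "0 \<le> C" by (simp add: second_order_powr_bound_def)
  obtain c where c: "0 \<le> c" and shift: "\<And>(f :: real ^ 'd \<Rightarrow> real) f' z. f \<in> sobolev_space s p \<Longrightarrow> f' \<in> borel_measurable borel \<Longrightarrow>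
      AE x in lborel. f x = f' x \<Longrightarrow>
      translation_energy p f' z \<le> ennreal (c * sobolev_seminorm s p f powr p * norm z powr (s * p))"
    by (rule translation_energy_le_sobolev_seminorm[OF p s, where 'd='d]) (rule that)
  obtain \<phi>' where \<phi>m: "\<phi>' \<in> borel_measurable borel" and \<phi>0: "\<And>x. 0 \<le> \<phi>' x"
    and \<phi>ae: "AE x in lborel. \<phi> x = \<phi>' x" and \<phi>1: "(\<integral>\<^sup>+x. ennreal (\<phi>' x) \<partial>lborel) = 1"
    using density_AE_borel[of \<phi>] assms(5) by blast
  define P where "P = enn2real (\<integral>\<^sup>+x. ennreal (\<phi>' x powr p) \<partial>lborel)"
  have "(\<integral>\<^sup>+x. ennreal (\<bar>\<phi>' x\<bar> powr p) \<partial>lborel) < \<infinity>"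
    using Lp_space_AE_borel[OF _ \<phi>m \<phi>ae] assms(5) by blast
  then have P: "0 \<le> P" "(\<integral>\<^sup>+x. ennreal (\<phi>' x powr p) \<partial>lborel) \<le> ennreal P"
    using \<phi>0 by (auto simp: P_def)
  have moment: "(\<integral>\<^sup>+x. ennreal (norm x powr s * \<phi>' x) \<partial>lborel) \<le> ennreal K1"
  proof -
    have "(\<integral>\<^sup>+x. ennreal (norm x powr s * \<phi>' x) \<partial>lborel) = (\<integral>\<^sup>+x. ennreal (norm x powr s * \<phi> x) \<partial>lborel)"
      using \<phi>ae by (intro nn_integral_cong_AE) (auto elim: eventually_mono)
    then show ?thesis using assms(7) by (simp add: nn_integral_completion)
  qed
  \<comment> \<open>The scale \<open>m powr a\<close> gives the two error terms the same power of \<open>m\<close>.\<close>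
  define a where "a = (p - r) / (s * p + d * (p - 1))"
  define e where "e = (if p < 2 then s / (s * q + d) else s * q / (2 * (s * q + d)))"
  have den: "0 < s * p + d * (p - 1)" using p s d by (intro add_pos_pos) auto
  have sqd: "s * q + d = (s * p + d * (p - 1)) / (p - 1)"
    using p by (simp add: assms(2) add_divide_distrib)
  have e: "e = a * s"
    using p unfolding e_def a_def sqd r_def assms(2) by (auto simp: max_def divide_simps)
  have exponent: "a * (d * (p - 1)) + (r - p) = - (a * s * p)"
  proof -
    have "a * (s * p + d * (p - 1)) = p - r" using den by (simp add: a_def)
    then show ?thesis by (simp add: algebra_simps)
  qed
  define K where "K = (\<lambda>t. (2 powr (p - 1) * (2 * C * 2 powr p * P + K1 powr p * (c * t powr p))) powr (1 / p))"
  have approx: "\<exists>h. h \<in> mixtures m (location_scale_family \<phi>) \<and>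
      Lp_norm p (\<lambda>x. h x - f0 x) \<le> K (sobolev_seminorm s p f0) * real m powr - e"
    if f0: "f0 \<in> sobolev_space s p \<inter> densities" and m: "1 \<le> m" for f0 :: "real ^ 'd \<Rightarrow> real" and m :: nat
  proof -
    obtain f' where fm: "f' \<in> borel_measurable borel" and fn: "\<And>x. 0 \<le> f' x"
      and fae: "AE x in lborel. f0 x = f' x" and f1: "(\<integral>\<^sup>+x. ennreal (f' x) \<partial>lborel) = 1"
      using density_AE_borel[of f0] f0 by blast
    define T where "T = c * sobolev_seminorm s p f0 powr p"
    have T: "0 \<le> T" using c by (simp add: T_def)
    have trans: "translation_energy p f' z \<le> ennreal (T * norm z powr (s * p))" for z
      using shift[OF _ fm fae] f0 by (simp add: T_def)
    define \<nu> where "\<nu> = real m powr a"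
    have m0: "0 < real m" "0 < m" and \<nu>: "0 < \<nu>" using m by (auto simp: \<nu>_def)
    obtain \<mu> where \<mu>: "(\<integral>\<^sup>+x. ennreal (\<bar>(\<Sum>j<m. dilate \<nu> \<phi>' (x - \<mu> j)) / real m - f' x\<bar> powr p) \<partial>lborel)
     \<le> ennreal (2 powr (p - 1) * (2 * C * 2 powr p * P * \<nu> powr (real CARD('d) * (p - 1)) * real m powr (r - p)
          + K1 powr p * T * \<nu> powr - (s * p)))"
      using mixture_approximation_fixed_scale[OF fm \<phi>m p k T P(1) \<phi>0 \<phi>1 fn f1 P(2) moment trans bound \<nu> m0(2)]
      unfolding r_def
      by blast
    define R where "R = 2 powr (p - 1) * (2 * C * 2 powr p * P + K1 powr p * T)"
    have R: "0 \<le> R" using C P T by (simp add: R_def)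
    have "2 powr (p - 1) * (2 * C * 2 powr p * P * \<nu> powr (real CARD('d) * (p - 1)) * real m powr (r - p)
          + K1 powr p * T * \<nu> powr - (s * p)) = R * real m powr - (e * p)"
    proof -
      have "\<nu> powr (real CARD('d) * (p - 1)) * real m powr (r - p) = real m powr - (e * p)"
        using exponent by (simp add: \<nu>_def powr_powr d_def[symmetric] e flip: powr_add)
      moreover have "\<nu> powr - (s * p) = real m powr - (e * p)"
        by (simp add: \<nu>_def powr_powr e mult.assoc)
      ultimately show ?thesis by (simp add: R_def algebra_simps)
    qed
    note \<mu> = \<mu>[unfolded this]
    define h where "h = (\<lambda>x. \<Sum>j<m. (1 / real m) * dilate \<nu> \<phi> (x - \<mu> j))"
    have "h \<in> mixtures m (location_scale_family \<phi>)"
      unfolding h_def mixtures_def location_scale_family_def using \<nu> m0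
      by (intro CollectI exI[of _ "\<lambda>_. 1 / real m"] exI[of _ "\<lambda>j x. dilate \<nu> \<phi> (x - \<mu> j)"]) auto
    moreover have "Lp_norm p (\<lambda>x. h x - f0 x) \<le> (R * real m powr - (e * p)) powr (1 / p)"
    proof (rule Lp_norm_le)
      have "AE x in lborel. \<forall>j\<in>{..<m}. dilate \<nu> \<phi> (x - \<mu> j) = dilate \<nu> \<phi>' (x - \<mu> j)"
      proof (subst AE_ball_countable)
        show "\<forall>j\<in>{..<m}. AE x in lborel. dilate \<nu> \<phi> (x - \<mu> j) = dilate \<nu> \<phi>' (x - \<mu> j)"
        proof
          fix j
          show "AE x in lborel. dilate \<nu> \<phi> (x - \<mu> j) = dilate \<nu> \<phi>' (x - \<mu> j)"
            using AE_lborel_affine[OF \<phi>ae, of \<nu> "- (\<nu> *\<^sub>R \<mu> j)"] \<nu>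
            by (auto simp: dilate_def scaleR_right_diff_distrib elim: eventually_mono)
        qed
      qed auto
      then have "AE x in lborel. h x - f0 x = (\<Sum>j<m. dilate \<nu> \<phi>' (x - \<mu> j)) / real m - f' x"
        using fae by eventually_elim (simp add: h_def sum_divide_distrib)
      then have "(\<integral>\<^sup>+x. ennreal (\<bar>h x - f0 x\<bar> powr p) \<partial>lborel)
        = (\<integral>\<^sup>+x. ennreal (\<bar>(\<Sum>j<m. dilate \<nu> \<phi>' (x - \<mu> j)) / real m - f' x\<bar> powr p) \<partial>lborel)"
        by (intro nn_integral_cong_AE) (auto elim: eventually_mono)
      then show "(\<integral>\<^sup>+x. ennreal (\<bar>h x - f0 x\<bar> powr p) \<partial>lborel) \<le> ennreal (R * real m powr - (e * p))"
        using \<mu> by simp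
    qed (use R p in auto)
    moreover have "(R * real m powr - (e * p)) powr (1 / p) = K (sobolev_seminorm s p f0) * real m powr - e"
      using R p by (simp add: powr_mult powr_powr K_def R_def T_def)
    ultimately show ?thesis by auto
  qed
  have rate: "(if p < 2 then x * real m powr (- (s / (s * q + real CARD('d))))
      else x * real m powr (- (s * q / (2 * (s * q + real CARD('d)))))) = x * real m powr - e" for x m
    by (simp add: e_def d_def)
  show ?thesis
    unfolding rate
  proof (intro exI[of _ K] allI impI)
    fix f0 :: "real ^ 'd \<Rightarrow> real" assume "f0 \<in> sobolev_space s p \<inter> densities"
    then show "\<exists>f. \<forall>m\<ge>1. f m \<in> mixtures m (location_scale_family \<phi>) \<and>
        Lp_norm p (\<lambda>x. f m x - f0 x) \<le> K (sobolev_seminorm s p f0) * real m powr - e"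
      using approx by (intro choice) blast
  qed
qed

end
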